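(* Let $\beta_0,\beta_1,\beta_2,\beta_3\in\mathbb F$ be mutually distinct and equip $\mathcal P=\mathbb F[z_0,z_1]$ with the associated $\boxtimes$-module structure. For an integer $d\ge1$, the $\boxtimes$-module $\mathcal P_d$ is isomorphic to $V_d(a)$, where $$a=\frac{\beta_0-\beta_1}{\beta_0-\beta_3}\,\frac{\beta_2-\beta_3}{\beta_2-\beta_1}.$$
   Context: $\mathbb F$ is an algebraically closed field of characteristic $0$, and $\mathbb I=\{0,1,2,3\}$. The tetrahedron algebra $\boxtimes$ is the Lie algebra over $\mathbb F$ with generators $\{x_{ij}\mid i,j\in\mathbb I,\ i\ne j\}$ and relations: (i) $x_{ij}+x_{ji}=0$ for distinct $i,j$; (ii) $[x_{ij},x_{jk}]=2x_{ij}+2x_{jk}$ for mutually distinct $i,j,k$; (iii) $[x_{ij},[x_{ij},[x_{ij},x_{k\ell}]]]=4[x_{ij},x_{k\ell}]$ for mutually distinct $i,j,k,\ell$. Evaluation modules: let $\mathfrak{sl}_2=\mathfrak{sl}_2(\mathbb F)$ with basis $e,f,h$, $[h,e]=2e$, $[h,f]=-2f$, $[e,f]=h$. Put $x=2e-h$, $y=-2f-h$, $z=h$. For $a\in\mathbb F\setminus\{0,1\}$ let $EV_a:\boxtimes\to\mathfrak{sl}_2$ be the (surjective) Lie algebra homomorphism with $x_{12}\mapsto x$, $x_{23}\mapsto y$, $x_{31}\mapsto z$, $x_{03}\mapsto ay+(a-1)z$, $x_{01}\mapsto(1-a^{-1})z-a^{-1}x$, $x_{02}\mapsto(1-a)^{-1}x+a(1-a)^{-1}y$.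 For $d\ge0$ let $V_d$ be the irreducible $\mathfrak{sl}_2$-module of dimension $d+1$. For $d\ge1$, $V_d(a)$ is the $\boxtimes$-module obtained from $V_d$ by pulling back the action via $EV_a$. Polynomial module: $\mathcal P=\mathbb F[z_0,z_1]$, with $z_0,z_1$ commuting indeterminates, and $\mathcal P_d$ is the subspace of homogeneous polynomials of total degree $d$. Given mutually distinct $\beta_i\in\mathbb F$ $(i\in\mathbb I)$, let $z_2,z_3\in\mathcal P$ be the unique elements with $\sum_{i\in\mathbb I}z_i=0$ and $\sum_{i\in\mathbb I}\beta_iz_i=0$. There is a unique $\boxtimes$-module structure on $\mathcal P$ such that each element of $\boxtimes$ acts as a derivation of $\mathcal P$ and $x_{ij}.z_i=-z_i$, $x_{ij}.z_j=z_j$ for all distinct $i,j\in\mathbb I$. Each $\mathcal P_d$ is a $\boxtimes$-submodule. *)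

theory Defs
  imports "HOL-Analysis.Analysis" "HOL-Computational_Algebra.Polynomial"
begin

section \<open>Lie algebras and their modules\<close>

locale lie_algebra = vector_space scale
  for scale :: "'k::field \<Rightarrow> 'l::ab_group_add \<Rightarrow> 'l" +
  fixes bracket :: "'l \<Rightarrow> 'l \<Rightarrow> 'l"
  assumes bracket_add_left: "bracket (u + v) w = bracket u w + bracket v w"
    and bracket_add_right: "bracket u (v + w) = bracket u v + bracket u w"
    and bracket_scale_left: "bracket (scale c u) v = scale c (bracket u v)"
    and bracket_scale_right: "bracket u (scale c v) = scale c (bracket u v)"
    and bracket_self: "bracket u u = 0"
    and jacobi: "bracket u (bracket v w) + bracket v (bracket w u) + bracket w (bracket u v) = 0"

definition lie_hom ::
  "('k::field \<Rightarrow> 'l::ab_group_add \<Rightarrow> 'l) \<Rightarrow> ('l \<Rightarrow> 'l \<Rightarrow> 'l) \<Rightarrow>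
   ('k \<Rightarrow> 'm::ab_group_add \<Rightarrow> 'm) \<Rightarrow> ('m \<Rightarrow> 'm \<Rightarrow> 'm) \<Rightarrow> ('l \<Rightarrow> 'm) \<Rightarrow> bool"
where
  "lie_hom s1 b1 s2 b2 \<phi> \<longleftrightarrow>
     lie_algebra s1 b1 \<and> lie_algebra s2 b2 \<and> Vector_Spaces.linear s1 s2 \<phi> \<and>
     (\<forall>u v. \<phi> (b1 u v) = b2 (\<phi> u) (\<phi> v))"

text \<open>The module is the subspace \<open>W\<close> of the ambient vector space with scalar multiplication
  \<open>vscale\<close>; values of \<open>act\<close> outside \<open>W\<close> are irrelevant.\<close>

locale lie_module = L: lie_algebra scale bracket + V: vector_space vscale
  for scale :: "'k::field \<Rightarrow> 'l::ab_group_add \<Rightarrow> 'l"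
    and bracket :: "'l \<Rightarrow> 'l \<Rightarrow> 'l"
    and vscale :: "'k \<Rightarrow> 'v::ab_group_add \<Rightarrow> 'v" +
  fixes W :: "'v set" and act :: "'l \<Rightarrow> 'v \<Rightarrow> 'v"
  assumes subspace_W: "V.subspace W"
    and act_closed: "w \<in> W \<Longrightarrow> act u w \<in> W"
    and act_add_left: "w \<in> W \<Longrightarrow> act (u + v) w = act u w + act v w"
    and act_scale_left: "w \<in> W \<Longrightarrow> act (scale c u) w = vscale c (act u w)"
    and act_add_right: "w \<in> W \<Longrightarrow> w' \<in> W \<Longrightarrow> act u (w + w') = act u w + act u w'"
    and act_scale_right: "w \<in> W \<Longrightarrow> act u (vscale c w) = vscale c (act u w)"
    and act_bracket: "w \<in> W \<Longrightarrow> act (bracket u v) w = act u (act v w) - act v (act u w)"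

definition irreducible_lie_module ::
  "('k::field \<Rightarrow> 'l::ab_group_add \<Rightarrow> 'l) \<Rightarrow> ('l \<Rightarrow> 'l \<Rightarrow> 'l) \<Rightarrow>
   ('k \<Rightarrow> 'v::ab_group_add \<Rightarrow> 'v) \<Rightarrow> 'v set \<Rightarrow> ('l \<Rightarrow> 'v \<Rightarrow> 'v) \<Rightarrow> bool"
where
  "irreducible_lie_module sL bL sV W act \<longleftrightarrow>
     lie_module sL bL sV W act \<and> W \<noteq> {0} \<and>
     (\<forall>U. U \<subseteq> W \<and> lie_module sL bL sV U act \<longrightarrow> U = {0} \<or> U = W)"

definition lie_module_isomorphic ::
  "('k::field \<Rightarrow> 'l::ab_group_add \<Rightarrow> 'l) \<Rightarrow> ('l \<Rightarrow> 'l \<Rightarrow> 'l) \<Rightarrow>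
   ('k \<Rightarrow> 'v::ab_group_add \<Rightarrow> 'v) \<Rightarrow> 'v set \<Rightarrow> ('l \<Rightarrow> 'v \<Rightarrow> 'v) \<Rightarrow>
   ('k \<Rightarrow> 'w::ab_group_add \<Rightarrow> 'w) \<Rightarrow> 'w set \<Rightarrow> ('l \<Rightarrow> 'w \<Rightarrow> 'w) \<Rightarrow> bool"
where
  "lie_module_isomorphic sL bL s1 W1 act1 s2 W2 act2 \<longleftrightarrow>
     lie_module sL bL s1 W1 act1 \<and> lie_module sL bL s2 W2 act2 \<and>
     (\<exists>f. bij_betw f W1 W2 \<and>
        (\<forall>v\<in>W1. \<forall>w\<in>W1. f (v + w) = f v + f w) \<and>
        (\<forall>c. \<forall>v\<in>W1. f (s1 c v) = s2 c (f v)) \<and>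
        (\<forall>u. \<forall>v\<in>W1. f (act1 u v) = act2 u (f v)))"


section \<open>The tetrahedron algebra\<close>

text \<open>The presented Lie algebra is built as the set of formal Lie terms in the generators modulo
  the least congruence containing the vector space axioms, the Lie algebra axioms and the
  defining relations.  The index set is the four-element type \<open>4\<close>, whose elements are
  \<open>0, 1, 2, 3\<close>.\<close>

typedef tetra_index = "{(i, j). i \<noteq> j} :: (4 \<times> 4) set"
  by (rule exI[of _ "(0, 1)"]) simp

datatype 'k lie_term =
    Gen tetra_index
  | Zero
  | Add "'k lie_term" "'k lie_term"
  | Smul 'k "'k lie_term"
  | Brk "'k lie_term" "'k lie_term"

text \<open>\<open>gen_term i j\<close> is only meaningful for \<open>i \<noteq> j\<close>.\<close>

definition gen_term :: "4 \<Rightarrow> 4 \<Rightarrow> 'k lie_term" where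
  "gen_term i j = Gen (Abs_tetra_index (i, j))"

inductive tetra_eq :: "'k::field lie_term \<Rightarrow> 'k lie_term \<Rightarrow> bool" where
  refl: "tetra_eq s s"
| sym: "tetra_eq s t \<Longrightarrow> tetra_eq t s"
| trans: "tetra_eq s t \<Longrightarrow> tetra_eq t u \<Longrightarrow> tetra_eq s u"
| cong_Add: "tetra_eq s s' \<Longrightarrow> tetra_eq t t' \<Longrightarrow> tetra_eq (Add s t) (Add s' t')"
| cong_Smul: "tetra_eq s s' \<Longrightarrow> tetra_eq (Smul c s) (Smul c s')"
| cong_Brk: "tetra_eq s s' \<Longrightarrow> tetra_eq t t' \<Longrightarrow> tetra_eq (Brk s t) (Brk s' t')"
| Add_assoc: "tetra_eq (Add (Add s t) u) (Add s (Add t u))"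
| Add_commute: "tetra_eq (Add s t) (Add t s)"
| Add_Zero: "tetra_eq (Add Zero s) s"
| Add_inverse: "tetra_eq (Add (Smul (-1) s) s) Zero"
| Smul_Add: "tetra_eq (Smul c (Add s t)) (Add (Smul c s) (Smul c t))"
| Smul_plus: "tetra_eq (Smul (c + d) s) (Add (Smul c s) (Smul d s))"
| Smul_Smul: "tetra_eq (Smul c (Smul d s)) (Smul (c * d) s)"
| Smul_one: "tetra_eq (Smul 1 s) s"
| Brk_Add_left: "tetra_eq (Brk (Add s t) u) (Add (Brk s u) (Brk t u))"
| Brk_Add_right: "tetra_eq (Brk s (Add t u)) (Add (Brk s t) (Brk s u))"
| Brk_Smul_left: "tetra_eq (Brk (Smul c s) t) (Smul c (Brk s t))"
| Brk_Smul_right: "tetra_eq (Brk s (Smul c t)) (Smul c (Brk s t))"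
| Brk_self: "tetra_eq (Brk s s) Zero"
| Jacobi: "tetra_eq (Add (Add (Brk s (Brk t u)) (Brk t (Brk u s))) (Brk u (Brk s t))) Zero"
| rel_i: "i \<noteq> j \<Longrightarrow> tetra_eq (Add (gen_term i j) (gen_term j i)) Zero"
| rel_ii: "distinct [i, j, k] \<Longrightarrow>
    tetra_eq (Brk (gen_term i j) (gen_term j k))
      (Add (Smul 2 (gen_term i j)) (Smul 2 (gen_term j k)))"
| rel_iii: "distinct [i, j, k, l] \<Longrightarrow>
    tetra_eq (Brk (gen_term i j) (Brk (gen_term i j) (Brk (gen_term i j) (gen_term k l))))
      (Smul 4 (Brk (gen_term i j) (gen_term k l)))"

quotient_type (overloaded) 'k tetra = "'k::field lie_term" / tetra_eq
  by (intro equivpI reflpI sympI transpI) (blast intro: tetra_eq.intros)+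

instantiation tetra :: (field) ab_group_add
begin

lift_definition zero_tetra :: "'a tetra" is Zero .
lift_definition plus_tetra :: "'a tetra \<Rightarrow> 'a tetra \<Rightarrow> 'a tetra" is Add
  by (rule tetra_eq.cong_Add)
lift_definition uminus_tetra :: "'a tetra \<Rightarrow> 'a tetra" is "Smul (-1)"
  by (rule tetra_eq.cong_Smul)
definition minus_tetra :: "'a tetra \<Rightarrow> 'a tetra \<Rightarrow> 'a tetra" where
  "minus_tetra u v = u + (- v)"

instance
proof
  fix a b c :: "'a tetra"
  show "a + b + c = a + (b + c)" by transfer (rule tetra_eq.Add_assoc)
  show "a + b = b + a" by transfer (rule tetra_eq.Add_commute)
  show "0 + a = a" by transfer (rule tetra_eq.Add_Zero)
  show "- a + a = 0" by transfer (rule tetra_eq.Add_inverse)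
  show "a - b = a + - b" by (rule minus_tetra_def)
qed

end

lift_definition tetra_scale :: "'k::field \<Rightarrow> 'k tetra \<Rightarrow> 'k tetra" is Smul
  by (rule tetra_eq.cong_Smul)

lift_definition tetra_bracket :: "'k::field tetra \<Rightarrow> 'k tetra \<Rightarrow> 'k tetra" is Brk
  by (rule tetra_eq.cong_Brk)

lift_definition tetra_x :: "4 \<Rightarrow> 4 \<Rightarrow> 'k::field tetra" is gen_term .

lemma tetra_lie_algebra: "lie_algebra tetra_scale tetra_bracket"
proof
  fix a b :: "'k::field" and u v w :: "'k tetra"
  show "tetra_scale a (u + v) = tetra_scale a u + tetra_scale a v"
    by transfer (rule tetra_eq.Smul_Add)
  show "tetra_scale (a + b) u = tetra_scale a u + tetra_scale b u"
    by transfer (rule tetra_eq.Smul_plus)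
  show "tetra_scale a (tetra_scale b u) = tetra_scale (a * b) u"
    by transfer (rule tetra_eq.Smul_Smul)
  show "tetra_scale 1 u = u"
    by transfer (rule tetra_eq.Smul_one)
  show "tetra_bracket (u + v) w = tetra_bracket u w + tetra_bracket v w"
    by transfer (rule tetra_eq.Brk_Add_left)
  show "tetra_bracket u (v + w) = tetra_bracket u v + tetra_bracket u w"
    by transfer (rule tetra_eq.Brk_Add_right)
  show "tetra_bracket (tetra_scale a u) v = tetra_scale a (tetra_bracket u v)"
    by transfer (rule tetra_eq.Brk_Smul_left)
  show "tetra_bracket u (tetra_scale a v) = tetra_scale a (tetra_bracket u v)"
    by transfer (rule tetra_eq.Brk_Smul_right)
  show "tetra_bracket u u = 0"
    by transfer (rule tetra_eq.Brk_self)
  show "tetra_bracket u (tetra_bracket v w) + tetra_bracket v (tetra_bracket w u)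
      + tetra_bracket w (tetra_bracket u v) = 0"
    by transfer (rule tetra_eq.Jacobi)
qed


section \<open>The Lie algebra \<open>sl\<^sub>2\<close> and evaluation modules\<close>

text \<open>The triple \<open>(a, b, c)\<close> stands for \<open>a e + b f + c h\<close>.\<close>

type_synonym 'k sl2 = "'k \<times> 'k \<times> 'k"

definition sl2_e :: "'k::field sl2" where "sl2_e = (1, 0, 0)"
definition sl2_f :: "'k::field sl2" where "sl2_f = (0, 1, 0)"
definition sl2_h :: "'k::field sl2" where "sl2_h = (0, 0, 1)"

fun sl2_scale :: "'k::field \<Rightarrow> 'k sl2 \<Rightarrow> 'k sl2" where
  "sl2_scale r (a, b, c) = (r * a, r * b, r * c)"

fun sl2_bracket :: "'k::field sl2 \<Rightarrow> 'k sl2 \<Rightarrow> 'k sl2" where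
  "sl2_bracket (a, b, c) (a', b', c') =
     (2 * (c * a' - a * c'), - 2 * (c * b' - b * c'), a * b' - b * a')"

lemma sl2_basis_brackets:
  "sl2_bracket sl2_h sl2_e = sl2_scale 2 sl2_e"
  "sl2_bracket sl2_h sl2_f = sl2_scale (- 2) sl2_f"
  "sl2_bracket sl2_e sl2_f = sl2_h"
  by (simp_all add: sl2_e_def sl2_f_def sl2_h_def)

lemma sl2_lie_algebra: "lie_algebra (sl2_scale :: 'k::field \<Rightarrow> _) sl2_bracket"
  by unfold_locales (auto simp: algebra_simps zero_prod_def)

definition sl2_x :: "'k::field sl2" where "sl2_x = sl2_scale 2 sl2_e - sl2_h"
definition sl2_y :: "'k::field sl2" where "sl2_y = sl2_scale (- 2) sl2_f - sl2_h"
definition sl2_z :: "'k::field sl2" where "sl2_z = sl2_h"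

definition EV :: "'k::field \<Rightarrow> 'k tetra \<Rightarrow> 'k sl2" where
  "EV a = (THE \<phi>. lie_hom tetra_scale tetra_bracket sl2_scale sl2_bracket \<phi> \<and>
     \<phi> (tetra_x 1 2) = sl2_x \<and> \<phi> (tetra_x 2 3) = sl2_y \<and> \<phi> (tetra_x 3 1) = sl2_z \<and>
     \<phi> (tetra_x 0 3) = sl2_scale a sl2_y + sl2_scale (a - 1) sl2_z \<and>
     \<phi> (tetra_x 0 1) = sl2_scale (1 - inverse a) sl2_z - sl2_scale (inverse a) sl2_x \<and>
     \<phi> (tetra_x 0 2) = sl2_scale (inverse (1 - a)) sl2_x + sl2_scale (a * inverse (1 - a)) sl2_y)"

definition pullback_EV ::
  "'k::field \<Rightarrow> ('k sl2 \<Rightarrow> 'v \<Rightarrow> 'v) \<Rightarrow> 'k tetra \<Rightarrow> 'v \<Rightarrow> 'v" where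
  "pullback_EV a act u = act (EV a u)"

text \<open>A model of \<open>V\<^sub>d\<close>: an irreducible \<open>sl\<^sub>2\<close>-module of dimension \<open>d + 1\<close>, which is unique
  up to isomorphism.\<close>

definition is_sl2_V ::
  "nat \<Rightarrow> ('k::field \<Rightarrow> 'v::ab_group_add \<Rightarrow> 'v) \<Rightarrow> 'v set \<Rightarrow> ('k sl2 \<Rightarrow> 'v \<Rightarrow> 'v) \<Rightarrow> bool"
where
  "is_sl2_V d vscale V act \<longleftrightarrow>
     irreducible_lie_module sl2_scale sl2_bracket vscale V act \<and>
     vector_space.dim vscale V = d + 1"


section \<open>The polynomial module\<close>

text \<open>\<open>F[z\<^sub>0, z\<^sub>1]\<close> is the iterated polynomial ring: \<open>coeff (coeff p n) m\<close> is the coefficient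
  of \<open>z\<^sub>0\<^sup>m z\<^sub>1\<^sup>n\<close>.\<close>

definition poly_scale :: "'k::field \<Rightarrow> 'k poly poly \<Rightarrow> 'k poly poly" where
  "poly_scale c p = smult [:c:] p"

definition homogeneous_polys :: "nat \<Rightarrow> 'k::field poly poly set" where
  "homogeneous_polys d = {p. \<forall>m n. coeff (coeff p n) m \<noteq> 0 \<longrightarrow> m + n = d}"

definition poly_z :: "(4 \<Rightarrow> 'k::field) \<Rightarrow> 4 \<Rightarrow> 'k poly poly" where
  "poly_z \<beta> = (THE \<zeta>. \<zeta> 0 = [:[:0, 1:]:] \<and> \<zeta> 1 = [:0, 1:] \<and>
     (\<Sum>i\<in>UNIV. \<zeta> i) = 0 \<and> (\<Sum>i\<in>UNIV. poly_scale (\<beta> i) (\<zeta> i)) = 0)"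

definition poly_act :: "(4 \<Rightarrow> 'k::field) \<Rightarrow> 'k tetra \<Rightarrow> 'k poly poly \<Rightarrow> 'k poly poly" where
  "poly_act \<beta> = (THE act.
     lie_module tetra_scale tetra_bracket poly_scale UNIV act \<and>
     (\<forall>u p q. act u (p * q) = act u p * q + p * act u q) \<and>
     (\<forall>i j. i \<noteq> j \<longrightarrow>
        act (tetra_x i j) (poly_z \<beta> i) = - poly_z \<beta> i \<and>
        act (tetra_x i j) (poly_z \<beta> j) = poly_z \<beta> j))"

end

theory Submission
  imports Defs
begin

text \<open>
  Both modules are pullbacks of \<open>sl\<^sub>2\<close>-modules along the evaluation homomorphism.  In the basis
  \<open>z\<^sub>1, z\<^sub>3\<close> of the linear forms, let \<open>h, e, f\<close> act as the derivations with \<open>h z\<^sub>1 = z\<^sub>1\<close>,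
  \<open>h z\<^sub>3 = - z\<^sub>3\<close>, \<open>e z\<^sub>1 = 0\<close>, \<open>e z\<^sub>3 = s z\<^sub>1\<close>, \<open>f z\<^sub>1 = t z\<^sub>3\<close>, \<open>f z\<^sub>3 = 0\<close>, where
  \<open>s = (\<beta>\<^sub>1 - \<beta>\<^sub>0) / (\<beta>\<^sub>3 - \<beta>\<^sub>0)\<close> and \<open>t = 1 / s\<close>.  The value of \<open>s\<close> is forced by \<open>x\<^sub>1\<^sub>2 z\<^sub>2 = z\<^sub>2\<close>, and
  \<open>x\<^sub>0\<^sub>3 z\<^sub>0 = - z\<^sub>0\<close> then forces \<open>a\<close> to be the stated cross ratio.  A derivation is determined by its
  values on any two of the \<open>z\<^sub>i\<close>, so the tetrahedron action is this \<open>sl\<^sub>2\<close>-action composed with \<open>EV a\<close>.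
  Finally \<open>z\<^sub>1\<^sup>d\<close> is a highest weight vector of weight \<open>d\<close> in the \<open>(d + 1)\<close>-dimensional space of forms of
  degree \<open>d\<close>; both it and \<open>V\<^sub>d\<close> have a basis of \<open>f\<close>-iterates of such a vector, on which the action
  depends on \<open>d\<close> only.
\<close>

section \<open>The evaluation homomorphism\<close>

lemma tetra_induct [case_names gen zero add scale bracket]:
  fixes P :: "'k::field tetra \<Rightarrow> bool"
  assumes gen: "\<And>i j. i \<noteq> j \<Longrightarrow> P (tetra_x i j)"
    and zero: "P 0"
    and add: "\<And>u v. P u \<Longrightarrow> P v \<Longrightarrow> P (u + v)"
    and scale: "\<And>c u. P u \<Longrightarrow> P (tetra_scale c u)"
    and bracket: "\<And>u v. P u \<Longrightarrow> P v \<Longrightarrow> P (tetra_bracket u v)"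
  shows "P u"
proof -
  have "P (abs_tetra t)" for t
  proof (induction t)
    case (Gen g)
    obtain i j where "Rep_tetra_index g = (i, j)" "i \<noteq> j"
      using Rep_tetra_index [of g] by auto
    then show ?case
      using gen [of i j] Rep_tetra_index_inverse [of g]
      by (simp add: tetra_x.abs_eq gen_term_def)
  qed (use zero add scale bracket in
      \<open>simp_all flip: zero_tetra.abs_eq plus_tetra.abs_eq tetra_scale.abs_eq tetra_bracket.abs_eq\<close>)
  then show ?thesis
    by (induct u rule: tetra.abs_induct)
qed

lemma tetra_x_flip: "i \<noteq> j \<Longrightarrow> tetra_x j i = - (tetra_x i j :: 'k::field tetra)"
proof -
  assume "i \<noteq> j"
  then have "tetra_x i j + tetra_x j i = (0 :: 'k tetra)"
    by transfer (rule tetra_eq.rel_i)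
  then show ?thesis by (simp add: eq_neg_iff_add_eq_0 add.commute)
qed

primrec lie_term_eval ::
  "('k \<Rightarrow> 'l \<Rightarrow> 'l) \<Rightarrow> ('l \<Rightarrow> 'l \<Rightarrow> 'l) \<Rightarrow> (4 \<Rightarrow> 4 \<Rightarrow> 'l) \<Rightarrow> 'k lie_term \<Rightarrow> 'l::ab_group_add"
where
  "lie_term_eval s b g (Gen x) = (case Rep_tetra_index x of (i, j) \<Rightarrow> g i j)"
| "lie_term_eval s b g Zero = 0"
| "lie_term_eval s b g (Add t u) = lie_term_eval s b g t + lie_term_eval s b g u"
| "lie_term_eval s b g (Smul c t) = s c (lie_term_eval s b g t)"
| "lie_term_eval s b g (Brk t u) = b (lie_term_eval s b g t) (lie_term_eval s b g u)"

lemma lie_term_eval_gen_term: "i \<noteq> j \<Longrightarrow> lie_term_eval s b g (gen_term i j) = g i j"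
  by (simp add: gen_term_def Abs_tetra_index_inverse)

lemma lie_hom_add: "lie_hom s1 b1 s2 b2 \<phi> \<Longrightarrow> \<phi> (u + v) = \<phi> u + \<phi> v"
  unfolding lie_hom_def Vector_Spaces.linear_def by (metis module_hom.add)

lemma lie_hom_scale: "lie_hom s1 b1 s2 b2 \<phi> \<Longrightarrow> \<phi> (s1 c u) = s2 c (\<phi> u)"
  unfolding lie_hom_def Vector_Spaces.linear_def by (metis module_hom.scale)

lemma lie_hom_bracket: "lie_hom s1 b1 s2 b2 \<phi> \<Longrightarrow> \<phi> (b1 u v) = b2 (\<phi> u) (\<phi> v)"
  unfolding lie_hom_def by simp

lemma lie_hom_zero: "lie_hom s1 b1 s2 b2 \<phi> \<Longrightarrow> \<phi> 0 = 0"
  using lie_hom_add [of s1 b1 s2 b2 \<phi> 0 0] by simp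

lemma lie_hom_minus: "lie_hom s1 b1 s2 b2 \<phi> \<Longrightarrow> \<phi> (- u) = - \<phi> u"
  using lie_hom_add [of s1 b1 s2 b2 \<phi> u "- u"] lie_hom_zero [of s1 b1 s2 b2 \<phi>]
  by (simp add: eq_neg_iff_add_eq_0 add.commute)

text \<open>Universal property of the presentation. Apart from the equivalence and congruence rules,
  every rule of \<open>tetra_eq\<close> evaluates to a vector space or Lie algebra axiom of the
  target or to one of the hypotheses \<open>i\<close>, \<open>ii\<close>, \<open>iii\<close>. So
  \<open>lie_term_eval\<close> is constant on classes and descends to the quotient.\<close>

lemma tetra_lift:
  fixes s :: "'k::field \<Rightarrow> 'l::ab_group_add \<Rightarrow> 'l"
  assumes L: "lie_algebra s b"
    and i: "\<And>i j. i \<noteq> j \<Longrightarrow> g i j + g j i = 0"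
    and ii: "\<And>i j k. distinct [i, j, k] \<Longrightarrow> b (g i j) (g j k) = s 2 (g i j) + s 2 (g j k)"
    and iii: "\<And>i j k l. distinct [i, j, k, l] \<Longrightarrow>
      b (g i j) (b (g i j) (b (g i j) (g k l))) = s 4 (b (g i j) (g k l))"
  obtains \<phi> where "lie_hom tetra_scale tetra_bracket s b \<phi>"
    "\<And>i j. i \<noteq> j \<Longrightarrow> \<phi> (tetra_x i j) = g i j"
proof -
  interpret lie_algebra s b by (rule L)
  let ?ev = "lie_term_eval s b g"
  have ev_cong: "?ev t = ?ev u" if "tetra_eq t u" for t u
    using that
  proof (induction rule: tetra_eq.induct)
    case (rel_ii i j k)
    then show ?case using ii [of i j k] by (simp add: lie_term_eval_gen_term)
  next
    case (rel_iii i j k l)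
    then show ?case using iii [of i j k l] by (simp add: lie_term_eval_gen_term)
  next
    case (Jacobi t u v)
    then show ?case using jacobi [of "?ev t" "?ev u" "?ev v"] by simp
  qed (auto simp: lie_term_eval_gen_term i bracket_add_left bracket_add_right bracket_scale_left
      bracket_scale_right bracket_self jacobi scale_right_distrib scale_left_distrib add_ac)
  define \<phi> where "\<phi> u = ?ev (rep_tetra u)" for u
  have \<phi>_abs: "\<phi> (abs_tetra t) = ?ev t" for t
    unfolding \<phi>_def
    by (rule ev_cong) (rule Quotient3_rep_abs [OF Quotient3_tetra], rule tetra_eq.refl)
  show thesis
  proof
    show "\<phi> (tetra_x i j) = g i j" if "i \<noteq> j" for i j
      using that by (simp add: tetra_x.abs_eq \<phi>_abs lie_term_eval_gen_term)
    have add: "\<phi> (u + v) = \<phi> u + \<phi> v" for u v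
      by (induct u rule: tetra.abs_induct; induct v rule: tetra.abs_induct)
        (simp add: plus_tetra.abs_eq \<phi>_abs)
    have scale: "\<phi> (tetra_scale c u) = s c (\<phi> u)" for c u
      by (induct u rule: tetra.abs_induct) (simp add: tetra_scale.abs_eq \<phi>_abs)
    have brk: "\<phi> (tetra_bracket u v) = b (\<phi> u) (\<phi> v)" for u v
      by (induct u rule: tetra.abs_induct; induct v rule: tetra.abs_induct)
        (simp add: tetra_bracket.abs_eq \<phi>_abs)
    interpret T: lie_algebra "tetra_scale :: 'k \<Rightarrow> _" tetra_bracket
      by (rule tetra_lie_algebra)
    have "Vector_Spaces.linear tetra_scale s \<phi>"
      by unfold_locales (rule add scale)+
    then show "lie_hom tetra_scale tetra_bracket s b \<phi>"
      using L tetra_lie_algebra brk by (auto simp: lie_hom_def)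
  qed
qed

lemma tetra_hom_unique:
  assumes "lie_hom tetra_scale tetra_bracket s b \<phi>" "lie_hom tetra_scale tetra_bracket s b \<psi>"
    and "\<And>i j. i \<noteq> j \<Longrightarrow> \<phi> (tetra_x i j) = \<psi> (tetra_x i j)"
  shows "\<phi> = \<psi>"
proof
  show "\<phi> u = \<psi> u" for u
    by (induction u rule: tetra_induct)
      (simp_all add: assms(3) lie_hom_zero [OF assms(1)] lie_hom_zero [OF assms(2)]
        lie_hom_add [OF assms(1)] lie_hom_add [OF assms(2)] lie_hom_scale [OF assms(1)]
        lie_hom_scale [OF assms(2)] lie_hom_bracket [OF assms(1)] lie_hom_bracket [OF assms(2)])
qed

text \<open>Under the hypothesis \<open>u\<close> has eigenvalues \<open>1, - 1\<close>, so \<open>ad u\<close> has eigenvalues \<open>0, 2, - 2\<close>.\<close>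

lemma sl2_ad_cubed:
  fixes u v :: "'k::field sl2"
  assumes "case u of (p, q, c) \<Rightarrow> c * c + p * q = 1"
  shows "sl2_bracket u (sl2_bracket u (sl2_bracket u v)) = sl2_scale 4 (sl2_bracket u v)"
proof (cases u)
  case u: (fields p q c)
  show ?thesis
  proof (cases v)
    case v: (fields p' q' c')
    have "c * c + p * q = 1" using assms u by simp
    then show ?thesis
      unfolding u v sl2_bracket.simps sl2_scale.simps prod.inject
      by (intro conjI; algebra)
  qed
qed

section \<open>The evaluation homomorphism in coordinates\<close>

lemma index4_cases: "i = 0 \<or> i = 1 \<or> i = 2 \<or> i = (3 :: 4)"
  \<comment> \<open>\<open>exhaust_4\<close> lists the residues as 1, 2, 3, 4, and 4 equals 0 in
    this type.\<close>
  using exhaust_4 [of i] by auto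

text \<open>The six prescribed images in coordinates with respect to e, f, h, continued to reversed
  pairs by a sign so that relation (i) holds by construction. Equal indices get the default
  0.\<close>

definition EV_gen :: "'k::field \<Rightarrow> 4 \<Rightarrow> 4 \<Rightarrow> 'k sl2" where
  "EV_gen a i j =
    (let x = (2, 0, - 1); y = (0, - 2, - 1); z = (0, 0, 1);
         x03 = (0, - 2 * a, - 1); x01 = (- 2 * inverse a, 0, 1);
         x02 = (2 * inverse (1 - a), - 2 * a * inverse (1 - a), - (1 + a) * inverse (1 - a))
     in if (i, j) = (1, 2) then x else if (i, j) = (2, 1) then - x
     else if (i, j) = (2, 3) then y else if (i, j) = (3, 2) then - y
     else if (i, j) = (3, 1) then z else if (i, j) = (1, 3) then - z
     else if (i, j) = (0, 3) then x03 else if (i, j) = (3, 0) then - x03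
     else if (i, j) = (0, 1) then x01 else if (i, j) = (1, 0) then - x01
     else if (i, j) = (0, 2) then x02 else if (i, j) = (2, 0) then - x02 else 0)"

text \<open>Mixed products of a, 1/a and 1/(1 - a) are rewritten as sums, which turns the relations
  below into identities that simplification can decide. The versions with a trailing factor
  \<open>r\<close> match products that \<open>algebra_simps\<close> has nested to the right.\<close>

lemma partial_fractions:
  fixes a r :: "'k::field"
  assumes "a \<noteq> 0" "a \<noteq> 1"
  defines "b \<equiv> inverse a" and "c \<equiv> inverse (1 - a)"
  shows "a * b = 1" "a * c = c - 1" "b * c = b + c"
    "a * (b * r) = r" "a * (c * r) = c * r - r" "b * (c * r) = b * r + c * r"
proof -
  show *: "a * b = 1" "a * c = c - 1" "b * c = b + c"
    using assms(1,2) by (simp_all add: b_def c_def field_simps)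
  show "a * (b * r) = r" "a * (c * r) = c * r - r" "b * (c * r) = b * r + c * r"
    unfolding mult.assoc [symmetric] * by (simp_all add: algebra_simps)
qed

text \<open>The third claim is stronger than relation (iii): it holds for every \<open>v\<close>,
  because each generator goes to a traceless matrix of determinant - 1, which is the hypothesis of
  \<open>sl2_ad_cubed\<close>. The other two are finite checks over the indices.\<close>

lemma EV_gen_relations:
  fixes a :: "'k::field"
  assumes "a \<noteq> 0" "a \<noteq> 1"
  shows "i \<noteq> j \<Longrightarrow> EV_gen a i j + EV_gen a j i = 0"
    and "distinct [i, j, k] \<Longrightarrow> sl2_bracket (EV_gen a i j) (EV_gen a j k)
      = sl2_scale 2 (EV_gen a i j) + sl2_scale 2 (EV_gen a j k)"
    and "i \<noteq> j \<Longrightarrow> sl2_bracket (EV_gen a i j) (sl2_bracket (EV_gen a i j)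
      (sl2_bracket (EV_gen a i j) v)) = sl2_scale 4 (sl2_bracket (EV_gen a i j) v)"
proof -
  define b c where "b = inverse a" and "c = inverse (1 - a)"
  note partial_fractions = partial_fractions [OF assms, folded b_def c_def]
  note gen = EV_gen_def Let_def b_def [symmetric] c_def [symmetric]
  show "i \<noteq> j \<Longrightarrow> EV_gen a i j + EV_gen a j i = 0"
    using index4_cases [of i] index4_cases [of j]
    by (elim disjE) (simp_all add: EV_gen_def Let_def zero_prod_def)
  show "distinct [i, j, k] \<Longrightarrow> sl2_bracket (EV_gen a i j) (EV_gen a j k)
      = sl2_scale 2 (EV_gen a i j) + sl2_scale 2 (EV_gen a j k)"
    using index4_cases [of i] index4_cases [of j] index4_cases [of k]
    by (elim disjE; simp add: gen; (simp add: algebra_simps partial_fractions)?)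
  assume "i \<noteq> j"
  show "sl2_bracket (EV_gen a i j) (sl2_bracket (EV_gen a i j)
      (sl2_bracket (EV_gen a i j) v)) = sl2_scale 4 (sl2_bracket (EV_gen a i j) v)"
  proof (rule sl2_ad_cubed)
    show "case EV_gen a i j of (p, q, c) \<Rightarrow> c * c + p * q = 1"
      using \<open>i \<noteq> j\<close> index4_cases [of i] index4_cases [of j]
      by (elim disjE; simp add: gen; (simp add: algebra_simps partial_fractions)?)
  qed
qed

lemma EV_values:
  "EV_gen a 1 2 = sl2_x" "EV_gen a 2 3 = sl2_y" "EV_gen a 3 1 = sl2_z"
  "EV_gen a 0 3 = sl2_scale a sl2_y + sl2_scale (a - 1) sl2_z"
  "a \<noteq> 0 \<Longrightarrow>
    EV_gen a 0 1 = sl2_scale (1 - inverse a) sl2_z - sl2_scale (inverse a) sl2_x"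
  "a \<noteq> 1 \<Longrightarrow>
    EV_gen a 0 2 = sl2_scale (inverse (1 - a)) sl2_x + sl2_scale (a * inverse (1 - a)) sl2_y"
  for a :: "'k::field"
  by (simp_all add: EV_gen_def Let_def sl2_x_def sl2_y_def sl2_z_def sl2_e_def sl2_f_def sl2_h_def
      field_simps)

text \<open>\<open>EV a\<close> is a definite description. Existence comes from
  \<open>tetra_lift\<close>. For uniqueness, the six prescribed values determine the six reversed
  generators by sign, and a homomorphism is determined by its values on generators.\<close>

lemma EV:
  fixes a :: "'k::field"
  assumes a: "a \<noteq> 0" "a \<noteq> 1"
  shows lie_hom_EV: "lie_hom tetra_scale tetra_bracket sl2_scale sl2_bracket (EV a)"
    and EV_tetra_x: "\<And>i j. i \<noteq> j \<Longrightarrow> EV a (tetra_x i j) = EV_gen a i j"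
proof -
  obtain \<phi> where \<phi>: "lie_hom tetra_scale tetra_bracket sl2_scale sl2_bracket \<phi>"
      "\<And>i j. i \<noteq> j \<Longrightarrow> \<phi> (tetra_x i j) = EV_gen a i j"
    by (rule tetra_lift [OF sl2_lie_algebra, of "EV_gen a"])
      (use EV_gen_relations [OF a] in auto)
  have "EV a = \<phi>"
    unfolding EV_def
  proof (rule the_equality, goal_cases)
    case 1
    show ?case using \<phi>(1) by (simp add: \<phi>(2) EV_values a)
  next
    case (2 \<psi>)
    then have hom: "lie_hom tetra_scale tetra_bracket sl2_scale sl2_bracket \<psi>" by blast
    have main: "\<psi> (tetra_x i j) = \<phi> (tetra_x i j)"
      if "(i, j) \<in> {(1,2), (2,3), (3,1), (0,3), (0,1), (0,2)}" for i j
      using 2 that by (auto simp: \<phi>(2) EV_values a)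
    show ?case
    proof (rule tetra_hom_unique [OF hom \<phi>(1)])
      fix i j :: 4 assume "i \<noteq> j"
      then have "(i, j) \<in> {(1,2), (2,3), (3,1), (0,3), (0,1), (0,2)} \<or>
          (j, i) \<in> {(1,2), (2,3), (3,1), (0,3), (0,1), (0,2)}"
        using index4_cases [of i] index4_cases [of j] by (elim disjE) simp_all
      then show "\<psi> (tetra_x i j) = \<phi> (tetra_x i j)"
      proof
        assume "(j, i) \<in> {(1,2), (2,3), (3,1), (0,3), (0,1), (0,2)}"
        with main [of j i] show ?thesis
          by (simp only: tetra_x_flip [OF \<open>i \<noteq> j\<close> [symmetric]] lie_hom_minus [OF hom]
              lie_hom_minus [OF \<phi>(1)])
      qed (rule main)
    qed
  qed
  then show "lie_hom tetra_scale tetra_bracket sl2_scale sl2_bracket (EV a)"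
    "\<And>i j. i \<noteq> j \<Longrightarrow> EV a (tetra_x i j) = EV_gen a i j"
    using \<phi> by auto
qed

section \<open>Highest weight modules of \<open>sl\<^sub>2\<close>\<close>

lemma lie_module_pullback:
  assumes \<phi>: "lie_hom s1 b1 s2 b2 \<phi>" and M: "lie_module s2 b2 vscale W act"
  shows "lie_module s1 b1 vscale W (\<lambda>u. act (\<phi> u))"
proof -
  interpret M: lie_module s2 b2 vscale W act by (rule M)
  have "lie_algebra s1 b1" "module_hom s1 s2 \<phi>" "\<And>u v. \<phi> (b1 u v) = b2 (\<phi> u) (\<phi> v)"
    using \<phi> by (auto simp: lie_hom_def Vector_Spaces.linear_def)
  then show ?thesis
    by (auto intro!: lie_module.intro lie_module_axioms.intro M.V.vector_space_axioms M.subspace_W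
        simp: module_hom.add module_hom.scale M.act_closed M.act_add_left M.act_scale_left
          M.act_add_right M.act_scale_right M.act_bracket)
qed

section \<open>Linear relations in a space with a finite spanning set\<close>

context vector_space
begin

text \<open>The relation is indexed by k, not by the set of vectors, so a repetition
  \<open>w i = w j\<close> is a case of its own, settled by the coefficients 1 and - 1. Without
  repetition, n + 1 vectors are too many to be independent in the span of n.\<close>

lemma linear_relation_exists:
  fixes w :: "nat \<Rightarrow> 'b"
  assumes "finite T" "card T \<le> n" "\<And>k. k \<le> n \<Longrightarrow> w k \<in> span T"
  obtains c where "(\<Sum>k\<le>n. scale (c k) (w k)) = 0" "\<exists>k\<le>n. c k \<noteq> 0"
proof (cases "inj_on w {..n}")
  case True
  have "dependent (w ` {..n})"
  proof (rule ccontr)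
    assume "independent (w ` {..n})"
    with assms have "card (w ` {..n}) \<le> card T"
      by (intro conjunct2 [OF independent_span_bound]) auto
    with assms True show False by (simp add: card_image)
  qed
  then obtain u where u: "\<exists>v\<in>w ` {..n}. u v \<noteq> 0" "(\<Sum>v\<in>w ` {..n}. scale (u v) v) = 0"
    by (subst (asm) dependent_finite) auto
  show thesis
    by (rule that [of "u \<circ> w"]) (use u True in \<open>auto simp: sum.reindex\<close>)
next
  case False
  then obtain i j where ij: "i \<le> n" "j \<le> n" "i \<noteq> j" "w i = w j"
    by (auto simp: inj_on_def)
  let ?c = "\<lambda>k. if k = i then 1 else if k = j then - 1 else 0"
  have "(\<Sum>k\<le>n. scale (?c k) (w k)) = (\<Sum>k\<in>{i, j}. scale (?c k) (w k))"
    by (rule sum.mono_neutral_right) (use ij in auto)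
  also have "\<dots> = 0" using ij by simp
  finally show thesis using ij by (intro that [of ?c]) auto
qed

lemma finite_dim_spanning_set:
  assumes "dim W > 0"
  obtains T where "finite T" "card T = dim W" "W \<subseteq> span T"
proof -
  obtain T where T: "T \<subseteq> W" "independent T" "W \<subseteq> span T" "card T = dim W"
    by (rule basis_exists [of W]) blast
  \<comment> \<open>An infinite set has \<open>card\<close> 0, so positive dimension makes the basis
    finite.\<close>
  with assms show thesis by (intro that [of T]) (auto intro: card_ge_0_finite)
qed

end

section \<open>Weight vectors in sl_2-modules\<close>

locale sl2_module = lie_module sl2_scale sl2_bracket vscale W act
  for vscale :: "'k::field_char_0 \<Rightarrow> 'v::ab_group_add \<Rightarrow> 'v" and W act
begin

notation vscale (infixr \<open>\<odot>\<close> 75)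

abbreviation e where "e \<equiv> act sl2_e"
abbreviation f where "f \<equiv> act sl2_f"
abbreviation h where "h \<equiv> act sl2_h"

lemma zero_in_W: "0 \<in> W" and add_in_W: "\<And>u v. u \<in> W \<Longrightarrow> v \<in> W \<Longrightarrow> u + v \<in> W"
  and scale_in_W: "\<And>c v. v \<in> W \<Longrightarrow> c \<odot> v \<in> W"
  using subspace_W by (auto simp: V.subspace_def)

lemma sum_in_W: "(\<And>k. k \<in> S \<Longrightarrow> w k \<in> W) \<Longrightarrow> sum w S \<in> W"
  by (rule V.subspace_sum [OF subspace_W])

lemma act_zero: "act u 0 = 0"
  using act_scale_right [OF zero_in_W, of u 0] by simp

lemma act_sum:
  "finite S \<Longrightarrow> (\<And>k. k \<in> S \<Longrightarrow> w k \<in> W) \<Longrightarrow> act u (\<Sum>k\<in>S. c k \<odot> w k) = (\<Sum>k\<in>S. c k \<odot> act u (w k))"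
  by (induction S rule: finite_induct)
    (auto simp: act_zero act_add_right act_scale_right scale_in_W sum_in_W)

lemma act_triple:
  assumes "w \<in> W"
  shows "act (p, q, r) w = p \<odot> e w + q \<odot> f w + r \<odot> h w"
proof -
  have "(p, q, r) = sl2_scale p sl2_e + (sl2_scale q sl2_f + sl2_scale r sl2_h)"
    by (simp add: sl2_e_def sl2_f_def sl2_h_def)
  then show ?thesis
    using assms by (simp add: act_add_left act_scale_left add.assoc)
qed

lemma he: "w \<in> W \<Longrightarrow> h (e w) = e (h w) + 2 \<odot> e w"
  using act_bracket [of w sl2_h sl2_e]
  by (simp add: sl2_basis_brackets act_scale_left algebra_simps)

lemma hf: "w \<in> W \<Longrightarrow> h (f w) = f (h w) - 2 \<odot> f w"
  using act_bracket [of w sl2_h sl2_f] act_scale_left [of w "- 2" sl2_f]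
  by (simp only: sl2_basis_brackets) (simp add: algebra_simps)

lemma ef: "w \<in> W \<Longrightarrow> e (f w) = f (e w) + h w"
  using act_bracket [of w sl2_e sl2_f] by (simp add: sl2_basis_brackets algebra_simps)

text \<open>Applying h and subtracting \<open>\<mu> m\<close> times the relation kills the term of
  \<open>m\<close> and multiplies every other coefficient by the nonzero
  \<open>\<mu> k - \<mu> m\<close>. The induction hypothesis then applies to the shorter
  relation.\<close>

lemma eigenvectors_independent:
  assumes "finite S" "inj_on \<mu> S"
    and "\<And>k. k \<in> S \<Longrightarrow> w k \<in> W \<and> w k \<noteq> 0 \<and> h (w k) = \<mu> k \<odot> w k"
    and "(\<Sum>k\<in>S. c k \<odot> w k) = 0" "k \<in> S"
  shows "c k = 0"
  using assms
proof (induction S arbitrary: c k rule: finite_induct)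
  case empty
  then show ?case by simp
next
  case (insert m S)
  have "0 = h (\<Sum>k\<in>insert m S. c k \<odot> w k) - \<mu> m \<odot> (\<Sum>k\<in>insert m S. c k \<odot> w k)"
    using insert.prems by (simp add: act_zero)
  also have "h (\<Sum>k\<in>insert m S. c k \<odot> w k) = (\<Sum>k\<in>insert m S. c k \<odot> h (w k))"
    by (rule act_sum) (use insert in auto)
  also have "\<dots> = (\<Sum>k\<in>insert m S. c k \<odot> \<mu> k \<odot> w k)"
    by (rule sum.cong) (use insert.prems in auto)
  also have "\<dots> - \<mu> m \<odot> (\<Sum>k\<in>insert m S. c k \<odot> w k)
      = (\<Sum>k\<in>insert m S. ((\<mu> k - \<mu> m) * c k) \<odot> w k)"
    unfolding V.scale_sum_right sum_subtractf [symmetric]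
    by (intro sum.cong) (simp_all add: algebra_simps)
  also have "\<dots> = (\<Sum>k\<in>S. ((\<mu> k - \<mu> m) * c k) \<odot> w k)"
    using insert.hyps by simp
  finally have "(\<mu> k - \<mu> m) * c k = 0" if "k \<in> S" for k
    using that insert.prems by (intro insert.IH) (auto simp: inj_on_def)
  moreover have "\<mu> k - \<mu> m \<noteq> 0" if "k \<in> S" for k
    using that insert by (auto simp: inj_on_def)
  ultimately have S: "c k = 0" if "k \<in> S" for k
    using that by fastforce
  then have "c m \<odot> w m = 0"
    using insert by simp
  then have "c m = 0" using insert.prems by simp
  then show ?case using S insert.prems by auto
qed

text \<open>This is what makes strings of e- and f-iterates end: n + 1 vectors with distinct weights
  in a space of dimension at most n cannot all be nonzero.\<close>

lemma eigenvectors_vanish: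
  assumes T: "finite T" "card T \<le> n" "W \<subseteq> V.span T"
    and \<mu>: "inj_on \<mu> {..n}"
    and w: "\<And>k. k \<le> n \<Longrightarrow> w k \<in> W \<and> h (w k) = \<mu> k \<odot> w k"
  obtains k where "k \<le> n" "w k = 0"
proof (rule ccontr)
  assume "\<not> thesis"
  then have w': "\<And>k. k \<le> n \<Longrightarrow> w k \<in> W \<and> w k \<noteq> 0 \<and> h (w k) = \<mu> k \<odot> w k"
    using w that by blast
  obtain c where "(\<Sum>k\<le>n. c k \<odot> w k) = 0" "\<exists>k\<le>n. c k \<noteq> 0"
    using V.linear_relation_exists [OF T(1,2), of w] w T(3) by (metis subsetD)
  then show False
    using eigenvectors_independent [of "{..n}" \<mu> w c] \<mu> w' by auto
qed

text \<open>The f-string of a highest weight vector of weight d, with the matrix entries of e, f, h.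
  The family is indexed by all k, with \<open>w (Suc d) = 0\<close>, so that the formula for f has
  no exception at k = d. All constants depend on d only, which makes any two such modules
  isomorphic.\<close>

definition standard_basis :: "nat \<Rightarrow> (nat \<Rightarrow> 'v) \<Rightarrow> bool" where
  "standard_basis d w \<longleftrightarrow>
    (\<forall>k. w k \<in> W) \<and> w (Suc d) = 0 \<and> e (w 0) = 0 \<and>
    (\<forall>k. f (w k) = w (Suc k)) \<and>
    (\<forall>k. h (w k) = (of_nat d - 2 * of_nat k) \<odot> w k) \<and>
    (\<forall>k. e (w (Suc k)) = (of_nat (Suc k) * (of_nat d - of_nat k)) \<odot> w k) \<and>
    (\<forall>c. (\<Sum>k\<le>d. c k \<odot> w k) = 0 \<longrightarrow> (\<forall>k\<le>d. c k = 0)) \<and>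
    (\<forall>u\<in>W. \<exists>c. u = (\<Sum>k\<le>d. c k \<odot> w k))"

lemma standard_basis_independent:
  assumes "standard_basis d w" "(\<Sum>k\<le>d. c k \<odot> w k) = 0" "k \<le> d"
  shows "c k = 0"
proof -
  have "\<forall>c. (\<Sum>k\<le>d. c k \<odot> w k) = 0 \<longrightarrow> (\<forall>k\<le>d. c k = 0)"
    using assms(1) unfolding standard_basis_def by blast
  from this [rule_format, of c] assms(2,3) show ?thesis by simp
qed

section \<open>The f-string of a highest weight vector\<close>

context
  fixes w\<^sub>0 \<nu>
  assumes hw: "w\<^sub>0 \<in> W" "e w\<^sub>0 = 0" "h w\<^sub>0 = \<nu> \<odot> w\<^sub>0"
begin

lemma f_string_in_W: "(f ^^ k) w\<^sub>0 \<in> W"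
  by (induction k) (simp_all add: hw act_closed)

lemma h_f_string: "h ((f ^^ k) w\<^sub>0) = (\<nu> - 2 * of_nat k) \<odot> (f ^^ k) w\<^sub>0"
proof (induction k)
  case (Suc k)
  have "h ((f ^^ Suc k) w\<^sub>0) = ((\<nu> - 2 * of_nat k) - 2) \<odot> (f ^^ Suc k) w\<^sub>0"
    unfolding V.scale_left_diff_distrib [of "\<nu> - 2 * of_nat k" 2]
    using Suc by (simp add: hf f_string_in_W act_scale_right)
  then show ?case by (simp add: algebra_simps)
qed (simp add: hw)

text \<open>Moving e past one more f adds the weight of the vector in between, and the sum of \<nu>
  - 2j over j \<le> k is (k + 1)(\<nu> - k).\<close>

lemma e_f_string:
  "e ((f ^^ Suc k) w\<^sub>0) = (of_nat (Suc k) * (\<nu> - of_nat k)) \<odot> (f ^^ k) w\<^sub>0"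
proof (induction k)
  case (Suc k)
  have "e ((f ^^ Suc (Suc k)) w\<^sub>0) = f (e ((f ^^ Suc k) w\<^sub>0)) + h ((f ^^ Suc k) w\<^sub>0)"
    using ef [OF f_string_in_W [of "Suc k"]] by simp
  also have "\<dots> = (of_nat (Suc k) * (\<nu> - of_nat k) + (\<nu> - 2 * of_nat (Suc k))) \<odot> (f ^^ Suc k) w\<^sub>0"
    unfolding Suc h_f_string by (simp add: act_scale_right f_string_in_W V.scale_left_distrib)
  finally show ?case by (simp add: algebra_simps)
qed (simp add: hw ef act_zero)

text \<open>e sends the vector of index k + 1 to (k + 1)(d - k) times the one of index k. In
  characteristic 0 this factor is nonzero for k < d, so the string cannot stop before index
  d.\<close>

lemma f_string_nonzero:
  assumes "\<nu> = of_nat d" "w\<^sub>0 \<noteq> 0" "k \<le> d"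
  shows "(f ^^ k) w\<^sub>0 \<noteq> 0"
  using assms(3)
proof (induction k)
  case (Suc k)
  have "(of_nat d :: 'k) - of_nat k \<noteq> 0"
    using Suc.prems by simp
  then have "e ((f ^^ Suc k) w\<^sub>0) \<noteq> 0"
    unfolding e_f_string assms(1) using Suc by (simp del: of_nat_Suc)
  then show ?case using act_zero by metis
qed (simp add: assms)

lemma f_string_eigenvectors:
  "(f ^^ k) w\<^sub>0 \<in> W \<and> h ((f ^^ k) w\<^sub>0) = (\<nu> - 2 * of_nat k) \<odot> (f ^^ k) w\<^sub>0"
  by (simp add: f_string_in_W h_f_string)

lemma standard_basis_of_highest_weight_vector:
  assumes "\<nu> = of_nat d" "w\<^sub>0 \<noteq> 0"
    and T: "finite T" "card T \<le> Suc d" "W \<subseteq> V.span T"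
  shows "standard_basis d (\<lambda>k. (f ^^ k) w\<^sub>0)"
proof -
  let ?w = "\<lambda>k. (f ^^ k) w\<^sub>0"
  have inj: "inj_on (\<lambda>k. \<nu> - 2 * of_nat k) S" for S :: "nat set"
    by (auto simp: inj_on_def)
  \<comment> \<open>The d + 2 vectors of index at most d + 1 have distinct weights in a space
    spanned by d + 1 vectors, so one vanishes; by \<open>f_string_nonzero\<close> it is the
    last.\<close>
  obtain k where k: "k \<le> Suc d" "?w k = 0"
    by (rule eigenvectors_vanish [OF T inj f_string_eigenvectors])
  then have "\<not> k \<le> d"
    using f_string_nonzero [OF assms(1,2)] by blast
  with k have zero: "?w (Suc d) = 0"
    by (metis le_SucE)
  have indep: "\<forall>k\<le>d. c k = 0" if "(\<Sum>k\<le>d. c k \<odot> ?w k) = 0" for c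
  proof (intro allI impI)
    fix k assume "k \<le> d"
    show "c k = 0"
    proof (rule eigenvectors_independent [OF _ inj _ that])
      fix j assume "j \<in> {..d}"
      then have "?w j \<noteq> 0" using f_string_nonzero [OF assms(1,2)] by simp
      with f_string_eigenvectors [of j]
      show "?w j \<in> W \<and> ?w j \<noteq> 0 \<and> h (?w j) = (\<nu> - 2 * of_nat j) \<odot> ?w j" by blast
    qed (use \<open>k \<le> d\<close> in simp_all)
  qed
  have gen: "\<exists>c. u = (\<Sum>k\<le>d. c k \<odot> ?w k)" if "u \<in> W" for u
  proof -
    \<comment> \<open>Appending \<open>u\<close> as entry d + 1 gives too many vectors for the span
      of \<open>T\<close>. As the others are independent, \<open>u\<close> has a nonzero coefficient
      in the resulting relation, which can be solved for it.\<close>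
    let ?w' = "\<lambda>k. if k = Suc d then u else ?w k"
    have in_span: "?w' k \<in> V.span T" for k
      using subsetD [OF T(3) f_string_in_W] subsetD [OF T(3) that] by (simp only: simp_thms split: if_split)
    obtain c where c: "(\<Sum>k\<le>Suc d. c k \<odot> ?w' k) = 0" "\<exists>k\<le>Suc d. c k \<noteq> 0"
      by (rule V.linear_relation_exists [OF T(1,2), of ?w']) (rule in_span)
    then have eq: "(\<Sum>k\<le>d. c k \<odot> ?w k) + c (Suc d) \<odot> u = 0"
      by simp
    have "c (Suc d) \<noteq> 0"
    proof
      assume "c (Suc d) = 0"
      moreover from this eq have "\<forall>k\<le>d. c k = 0" by (intro indep) simp
      ultimately show False using c(2) by (metis le_SucE)
    qed
    then have "u = inverse (c (Suc d)) \<odot> (c (Suc d) \<odot> u)"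
      by simp
    also have "c (Suc d) \<odot> u = - (\<Sum>k\<le>d. c k \<odot> ?w k)"
      using eq by (simp only: add_eq_0_iff2 minus_minus)
    finally have "u = inverse (c (Suc d)) \<odot> (- (\<Sum>k\<le>d. c k \<odot> ?w k))" .
    then show ?thesis
      by (intro exI [of _ "\<lambda>k. - inverse (c (Suc d)) * c k"])
        (simp add: V.scale_sum_right sum_negf)
  qed
  show ?thesis
    unfolding standard_basis_def
  proof (intro conjI allI impI ballI)
    show "e ((f ^^ 0) w\<^sub>0) = 0" using hw by simp
    show "f (?w k) = ?w (Suc k)" for k by simp
    show "?w k \<in> W" for k by (rule f_string_in_W)
    show "?w (Suc d) = 0" by (rule zero)
    show "h (?w k) = (of_nat d - 2 * of_nat k) \<odot> ?w k" for k
      using h_f_string by (simp only: assms(1))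
    show "e (?w (Suc k)) = (of_nat (Suc k) * (of_nat d - of_nat k)) \<odot> ?w k" for k
      using e_f_string by (simp only: assms(1))
    show "c k = 0" if "(\<Sum>k\<le>d. c k \<odot> ?w k) = 0" "k \<le> d" for c k
      using indep [OF that(1)] that(2) by blast
    show "\<exists>c. u = (\<Sum>k\<le>d. c k \<odot> ?w k)" if "u \<in> W" for u
      by (rule gen [OF that])
  qed
qed

end

end

section \<open>Modules with standard bases for the same d are isomorphic\<close>

lemma sl2_standard_basis_isomorphism:
  assumes "sl2_module s1 W1 act1" "sl2_module s2 W2 act2"
    and w: "sl2_module.standard_basis s1 W1 act1 d w"
    and v: "sl2_module.standard_basis s2 W2 act2 d v"
  obtains \<phi> where "bij_betw \<phi> W1 W2"
    "\<And>x y. x \<in> W1 \<Longrightarrow> y \<in> W1 \<Longrightarrow> \<phi> (x + y) = \<phi> x + \<phi> y"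
    "\<And>c x. x \<in> W1 \<Longrightarrow> \<phi> (s1 c x) = s2 c (\<phi> x)"
    "\<And>u x. x \<in> W1 \<Longrightarrow> \<phi> (act1 u x) = act2 u (\<phi> x)"
proof -
  interpret M: sl2_module s1 W1 act1 by fact
  interpret N: sl2_module s2 W2 act2 by fact
  note w = w [unfolded M.standard_basis_def] and v = v [unfolded N.standard_basis_def]
  let ?L = "\<lambda>c. \<Sum>k\<le>d. s1 (c k) (w k)" and ?R = "\<lambda>c. \<Sum>k\<le>d. s2 (c k) (v k)"
  have L_eq: "\<forall>k\<le>d. c k = c' k" if "?L c = ?L c'" for c c'
  proof -
    have "?L (\<lambda>k. c k - c' k) = 0"
      using that by (simp add: M.V.scale_left_diff_distrib sum_subtractf)
    then show ?thesis using M.standard_basis_independent [OF assms(3)] by fastforce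
  qed
  have R_eq: "\<forall>k\<le>d. c k = c' k" if "?R c = ?R c'" for c c'
  proof -
    have "?R (\<lambda>k. c k - c' k) = 0"
      using that by (simp add: N.V.scale_left_diff_distrib sum_subtractf)
    then show ?thesis using N.standard_basis_independent [OF assms(4)] by fastforce
  qed
  have L: "\<exists>c. x = ?L c" if "x \<in> W1" for x using w that by blast
  have R: "\<exists>c. x = ?R c" if "x \<in> W2" for x using v that by blast
  have L_in: "?L c \<in> W1" and R_in: "?R c \<in> W2" for c
    using w v by (auto intro!: M.sum_in_W N.sum_in_W M.scale_in_W N.scale_in_W)
  \<comment> \<open>\<open>\<phi>\<close> copies coordinates from \<open>w\<close> to
    \<open>v\<close>. The chosen coordinate function is determined only on k \<le> d, which is all
    that \<open>?R\<close> reads.\<close>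
  define \<phi> where "\<phi> x = ?R (SOME c. x = ?L c)" for x
  have \<phi>: "\<phi> (?L c) = ?R c" for c
  proof -
    have "?L c = ?L (SOME c'. ?L c = ?L c')"
      by (rule someI [of "\<lambda>c'. ?L c = ?L c'"]) (rule HOL.refl)
    then have "\<forall>k\<le>d. c k = (SOME c'. ?L c = ?L c') k"
      by (rule L_eq)
    then show ?thesis unfolding \<phi>_def by (intro sum.cong) auto
  qed
  have add: "\<phi> (x + y) = \<phi> x + \<phi> y" if xy: "x \<in> W1" "y \<in> W1" for x y
  proof -
    obtain c c' where "x = ?L c" "y = ?L c'" using L xy by metis
    then show ?thesis
      using \<phi> [of c] \<phi> [of c'] \<phi> [of "\<lambda>k. c k + c' k"]
      by (simp add: M.V.scale_left_distrib N.V.scale_left_distrib sum.distrib)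
  qed
  have scale: "\<phi> (s1 r x) = s2 r (\<phi> x)" if "x \<in> W1" for r x
  proof -
    obtain c where "x = ?L c" using L \<open>x \<in> W1\<close> by metis
    then show ?thesis
      using \<phi> [of c] \<phi> [of "\<lambda>k. r * c k"] by (simp add: M.V.scale_sum_right N.V.scale_sum_right)
  qed
  have zero: "\<phi> 0 = 0" using \<phi> [of "\<lambda>_. 0"] by simp
  have sum: "\<phi> (\<Sum>k\<le>n. s1 (c k) (x k)) = (\<Sum>k\<le>n. s2 (c k) (\<phi> (x k)))"
    if "\<And>k. x k \<in> W1" for n :: nat and c x
    by (induction n) (use that in \<open>simp_all add: scale add M.scale_in_W M.sum_in_W\<close>)
  \<comment> \<open>Index d + 1 is included, where both sides are 0, so that f applied to the last
    basis vector needs no separate case.\<close>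
  have basis: "\<phi> (w k) = v k" if "k \<le> Suc d" for k
  proof (cases "k = Suc d")
    case True
    then show ?thesis using w v zero by simp
  next
    case False
    then have "k \<le> d" using that by simp
    then show ?thesis
      using \<phi> [of "\<lambda>j. if j = k then 1 else 0"] by (simp add: if_distrib [of "\<lambda>c. s1 c _"]
        if_distrib [of "\<lambda>c. s2 c _"] cong: if_cong)
  qed
  \<comment> \<open>By linearity, commuting with the action is checked on the basis, where e, f, h
    have the same matrices on both sides.\<close>
  have intertwine: "\<phi> (act1 u x) = act2 u (\<phi> x)"
    if x: "x \<in> W1" and u: "\<And>k. k \<le> d \<Longrightarrow> \<phi> (act1 u (w k)) = act2 u (v k)" for u x
  proof -
    obtain c where c: "x = ?L c" using L x by metis
    have "act1 u x = (\<Sum>k\<le>d. s1 (c k) (act1 u (w k)))"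
      unfolding c by (rule M.act_sum) (use w in auto)
    then have "\<phi> (act1 u x) = (\<Sum>k\<le>d. s2 (c k) (\<phi> (act1 u (w k))))"
      using w by (simp add: sum M.act_closed)
    also have "\<dots> = (\<Sum>k\<le>d. s2 (c k) (act2 u (v k)))"
      by (rule sum.cong) (simp_all add: u)
    also have "\<dots> = act2 u (?R c)"
      by (rule N.act_sum [symmetric]) (use v in auto)
    finally show ?thesis by (simp add: c \<phi>)
  qed
  have gens: "\<phi> (M.f x) = N.f (\<phi> x)" "\<phi> (M.h x) = N.h (\<phi> x)" "\<phi> (M.e x) = N.e (\<phi> x)"
    if x: "x \<in> W1" for x
  proof -
    show "\<phi> (M.f x) = N.f (\<phi> x)"
      by (rule intertwine [OF x]) (use w v in \<open>simp add: basis\<close>)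
    show "\<phi> (M.h x) = N.h (\<phi> x)"
      by (rule intertwine [OF x]) (use w v in \<open>simp add: basis scale\<close>)
    show "\<phi> (M.e x) = N.e (\<phi> x)"
    proof (rule intertwine [OF x])
      fix k assume "k \<le> d"
      then show "\<phi> (M.e (w k)) = N.e (v k)"
        by (cases k) (use w v zero in \<open>simp_all add: basis scale\<close>)
    qed
  qed
  have act: "\<phi> (act1 u x) = act2 u (\<phi> x)" if x: "x \<in> W1" for u x
  proof (cases u)
    case (fields p q r)
    have "\<phi> x \<in> W2" using L [OF x] R_in \<phi> by auto
    then show ?thesis
      using x by (simp add: fields M.act_triple N.act_triple add scale gens M.act_closed
        M.scale_in_W M.add_in_W)
  qed
  have "bij_betw \<phi> W1 W2"
    unfolding bij_betw_def
  proof
    show "inj_on \<phi> W1"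
    proof (rule inj_onI)
      fix x y assume "x \<in> W1" "y \<in> W1" and eq: "\<phi> x = \<phi> y"
      then obtain c c' where c: "x = ?L c" "y = ?L c'" using L by metis
      then have "\<forall>k\<le>d. c k = c' k" using R_eq eq by (simp add: \<phi>)
      then show "x = y" unfolding c by (intro sum.cong) auto
    qed
    show "\<phi> ` W1 = W2"
    proof
      show "\<phi> ` W1 \<subseteq> W2"
      proof
        fix y assume "y \<in> \<phi> ` W1"
        then obtain c where "y = \<phi> (?L c)" using L by blast
        then show "y \<in> W2" by (simp only: \<phi> R_in)
      qed
      show "W2 \<subseteq> \<phi> ` W1"
      proof
        fix y assume "y \<in> W2"
        then obtain c where "y = \<phi> (?L c)" using R \<phi> by metis
        then show "y \<in> \<phi> ` W1" using L_in by blast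
      qed
    qed
  qed
  then show thesis using that add scale act by blast
qed

section \<open>Polynomials in h, and irreducible modules\<close>

context sl2_module
begin

definition poly_h :: "'k poly \<Rightarrow> 'v \<Rightarrow> 'v" where
  "poly_h p v = (\<Sum>i\<le>degree p. coeff p i \<odot> (h ^^ i) v)"

lemma poly_h_eq_sum: "degree p \<le> n \<Longrightarrow> poly_h p v = (\<Sum>i\<le>n. coeff p i \<odot> (h ^^ i) v)"
  unfolding poly_h_def by (rule sum.mono_neutral_left) (auto simp: coeff_eq_0)

lemma h_power_in_W: "v \<in> W \<Longrightarrow> (h ^^ i) v \<in> W"
  by (induction i) (simp_all add: act_closed)

text \<open>Serves to split off a root \<mu> of p: if p(h) v = 0 and p = (X - \<mu>) q, then q(h) v
  is either 0 or an eigenvector of h.\<close>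

lemma poly_h_linear_factor:
  assumes v: "v \<in> W"
  shows "poly_h ([:- \<mu>, 1:] * q) v = h (poly_h q v) - \<mu> \<odot> poly_h q v"
proof -
  let ?n = "degree q"
  have "degree ([:- \<mu>, 1:] * q) \<le> Suc ?n"
    by (rule order_trans [OF degree_mult_le]) simp
  then have "poly_h ([:- \<mu>, 1:] * q) v = (\<Sum>i\<le>Suc ?n. coeff ([:- \<mu>, 1:] * q) i \<odot> (h ^^ i) v)"
    by (rule poly_h_eq_sum)
  also have "\<dots> = (\<Sum>i\<le>Suc ?n. coeff (pCons 0 q) i \<odot> (h ^^ i) v)
      - (\<Sum>i\<le>Suc ?n. (\<mu> * coeff q i) \<odot> (h ^^ i) v)"
    unfolding sum_subtractf [symmetric]
    by (intro sum.cong) (simp_all add: V.scale_left_diff_distrib)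
  \<comment> \<open>Multiplication by the indeterminate shifts the coefficients by one, that is, it
    applies h once more.\<close>
  also have "(\<Sum>i\<le>Suc ?n. coeff (pCons 0 q) i \<odot> (h ^^ i) v)
      = (\<Sum>i\<le>?n. coeff q i \<odot> h ((h ^^ i) v))"
    by (subst sum.atMost_Suc_shift) simp
  also have "\<dots> = h (poly_h q v)"
    unfolding poly_h_def by (rule act_sum [symmetric]) (simp_all add: h_power_in_W v)
  also have "(\<Sum>i\<le>Suc ?n. (\<mu> * coeff q i) \<odot> (h ^^ i) v) = \<mu> \<odot> poly_h q v"
    unfolding poly_h_eq_sum [of q "Suc ?n", OF le_SucI [OF order_refl]] V.scale_sum_right
    by (simp only: V.scale_scale)
  finally show ?thesis .
qed

lemma poly_h_in_W: "v \<in> W \<Longrightarrow> poly_h p v \<in> W"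
  unfolding poly_h_def by (intro sum_in_W scale_in_W h_power_in_W)

lemma first_zero_of_orbit:
  fixes g :: "'v \<Rightarrow> 'v"
  assumes "(g ^^ k) x = 0" "x \<noteq> 0"
  obtains n where "(g ^^ Suc n) x = 0" "(g ^^ n) x \<noteq> 0" "n < k"
proof -
  have "\<exists>n<k. (\<forall>i\<le>n. (g ^^ i) x \<noteq> 0) \<and> (g ^^ Suc n) x = 0"
    by (rule ex_least_nat_less) (use assms in simp_all)
  then show thesis using that by blast
qed

lemma submodule:
  assumes "V.subspace U" "U \<subseteq> W" "\<And>x u. u \<in> U \<Longrightarrow> act x u \<in> U"
  shows "lie_module sl2_scale sl2_bracket vscale U act"
proof (intro lie_module.intro lie_module_axioms.intro)
  note U = subsetD [OF assms(2)]
  fix x y u v c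
  show "u \<in> U \<Longrightarrow> act (x + y) u = act x u + act y u" by (rule act_add_left [OF U])
  show "u \<in> U \<Longrightarrow> act (sl2_scale c x) u = c \<odot> act x u" by (rule act_scale_left [OF U])
  show "u \<in> U \<Longrightarrow> v \<in> U \<Longrightarrow> act x (u + v) = act x u + act x v" by (rule act_add_right [OF U U])
  show "u \<in> U \<Longrightarrow> act x (c \<odot> u) = c \<odot> act x u" by (rule act_scale_right [OF U])
  show "u \<in> U \<Longrightarrow> act (sl2_bracket x y) u = act x (act y u) - act y (act x u)"
    by (rule act_bracket [OF U])
qed (fact assms L.lie_algebra_axioms V.vector_space_axioms)+

text \<open>Climbing from the eigenvector by e ends at a highest weight vector, and descending from
  there by f ends too. The end of the descent fixes the weight, irreducibility makes the string span
  the module, and comparing dimensions gives its length.\<close>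

lemma irreducible_standard_basis:
  assumes irr: "irreducible_lie_module sl2_scale sl2_bracket vscale W act"
    and dim: "V.dim W = d + 1"
    and v: "v \<in> W" "v \<noteq> 0" "h v = \<mu> \<odot> v"
  obtains w where "standard_basis d w"
proof -
  have "V.dim W > 0" using dim by simp
  then obtain T where "finite T" "card T = V.dim W" "W \<subseteq> V.span T"
    by (rule V.finite_dim_spanning_set)
  with dim have T: "finite T" "card T \<le> Suc d" "W \<subseteq> V.span T"
    by simp_all
  have e_string: "(e ^^ k) v \<in> W \<and> h ((e ^^ k) v) = (\<mu> + 2 * of_nat k) \<odot> (e ^^ k) v" for k
  proof (induction k)
    case (Suc k)
    have "h ((e ^^ Suc k) v) = ((\<mu> + 2 * of_nat k) + 2) \<odot> (e ^^ Suc k) v"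
      unfolding V.scale_left_distrib [of "\<mu> + 2 * of_nat k" 2]
      using Suc by (simp only: funpow.simps comp_apply he act_scale_right simp_thms)
    also have "(\<mu> + 2 * of_nat k) + 2 = \<mu> + 2 * of_nat (Suc k)" by simp
    finally show ?case using act_closed [of "(e ^^ k) v" sl2_e] Suc
      unfolding funpow.simps comp_apply by blast
  qed (simp add: v)
  have "inj_on (\<lambda>k. \<mu> + 2 * of_nat k) {..Suc d}" by (auto simp: inj_on_def)
  then obtain k where "(e ^^ k) v = 0"
    by (rule eigenvectors_vanish [OF T _ e_string])
  then obtain m where m: "(e ^^ Suc m) v = 0" "(e ^^ m) v \<noteq> 0"
    by (rule first_zero_of_orbit [OF _ v(2)])
  define w\<^sub>0 where "w\<^sub>0 = (e ^^ m) v"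
  define \<nu> where "\<nu> = \<mu> + 2 * of_nat m"
  have hw: "w\<^sub>0 \<in> W" "e w\<^sub>0 = 0" "h w\<^sub>0 = \<nu> \<odot> w\<^sub>0" and w\<^sub>0: "w\<^sub>0 \<noteq> 0"
    using m e_string [of m] by (simp_all add: w\<^sub>0_def \<nu>_def)
  let ?w = "\<lambda>k. (f ^^ k) w\<^sub>0"
  have inj: "inj_on (\<lambda>k. \<nu> - 2 * of_nat k) {..Suc d}" by (auto simp: inj_on_def)
  obtain k where k: "k \<le> Suc d" "?w k = 0"
    by (rule eigenvectors_vanish [OF T inj f_string_eigenvectors [OF hw]])
  from k(2) obtain n where n: "?w (Suc n) = 0" "?w n \<noteq> 0" "n < k"
    by (rule first_zero_of_orbit [OF _ w\<^sub>0])
  \<comment> \<open>e applied to the vanishing vector of index n + 1 gives this multiple of a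
    nonzero vector, so the weight \<nu> must be n.\<close>
  have "(of_nat (Suc n) * (\<nu> - of_nat n)) \<odot> ?w n = 0"
    using e_f_string [OF hw, of n] by (simp only: n(1) act_zero)
  then have \<nu>: "\<nu> = of_nat n"
    using n(2) by (simp del: of_nat_Suc)
  \<comment> \<open>The span of the whole infinite string is closed under f at once; its zero tail
    is dropped afterwards.\<close>
  have U: "lie_module sl2_scale sl2_bracket vscale (V.span (range ?w)) act"
  proof (rule submodule)
    show "V.span (range ?w) \<subseteq> W"
      by (rule V.span_minimal) (auto simp: f_string_in_W [OF hw] subspace_W)
    have w_in: "?w k \<in> V.span (range ?w)" for k by (rule V.span_base) simp
    have ew_in: "e (?w k) \<in> V.span (range ?w)" for k
    proof (cases k)
      case (Suc j)
      then show ?thesis using e_f_string [OF hw, of j] by (simp only: V.span_scale w_in)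
    qed (simp add: hw V.span_zero)
    have aw_in: "act x (?w k) \<in> V.span (range ?w)" for x k
      using ew_in [of k] w_in [of "Suc k"] w_in [of k]
      by (cases x) (simp add: act_triple f_string_in_W [OF hw] h_f_string [OF hw] V.span_add V.span_scale)
    fix x u assume "u \<in> V.span (range ?w)"
    then have "u \<in> W \<and> act x u \<in> V.span (range ?w)"
    proof (induction rule: V.span_induct_alt)
      case base
      then show ?case by (simp add: zero_in_W act_zero V.span_zero)
    next
      case (step c y z)
      then obtain k where "y = ?w k" by auto
      then show ?case
        using step aw_in [of x k] f_string_in_W [OF hw, of k]
        by (auto intro!: add_in_W scale_in_W V.span_add V.span_scale
            simp: act_add_right act_scale_right scale_in_W)
    qed
    then show "act x u \<in> V.span (range ?w)" by blast
  qed simp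
  have "w\<^sub>0 \<in> V.span (range ?w)"
    by (rule V.span_base) (auto intro: range_eqI [of _ _ 0])
  moreover have "V.span (range ?w) \<subseteq> W"
    by (rule V.span_minimal) (auto simp: f_string_in_W [OF hw] subspace_W)
  ultimately have span: "V.span (range ?w) = W"
    using irr U w\<^sub>0 unfolding irreducible_lie_module_def by blast
  have zero: "?w (j + Suc n) = 0" for j
    by (induction j) (use n(1) in \<open>simp_all add: act_zero\<close>)
  have "range ?w \<subseteq> V.span (?w ` {..n})"
  proof clarify
    fix k
    show "?w k \<in> V.span (?w ` {..n})"
    proof (cases "k \<le> n")
      case True
      then show ?thesis by (intro V.span_base) simp
    next
      case False
      then show ?thesis using zero [of "k - Suc n"] V.span_zero by simp
    qed
  qed
  then have "W \<subseteq> V.span (?w ` {..n})"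
    using span by (metis V.span_minimal V.subspace_span)
  then have "V.dim W \<le> card (?w ` {..n})"
    by (rule V.dim_le_card) simp
  also have "\<dots> \<le> Suc n"
    using card_image_le [of "{..n}" ?w] by simp
  \<comment> \<open>W is spanned by n + 1 vectors, so d \<le> n; conversely n < k \<le> d +
    1.\<close>
  finally have "n = d"
    using dim n(3) k(1) by simp
  then show thesis
    using standard_basis_of_highest_weight_vector [OF hw _ w\<^sub>0 T] \<nu> that by blast
qed

end

text \<open>Algebraic closedness enters here, to produce an eigenvector of h: the d + 2 vectors v, h
  v, ..., h^(d+1) v are dependent, so p(h) v = 0 for some nonzero p.\<close>

lemma sl2_V_standard_basis:
  fixes vscale :: "'k::{alg_closed_field, field_char_0} \<Rightarrow> 'v::ab_group_add \<Rightarrow> 'v"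
  assumes "is_sl2_V d vscale V act"
  shows "sl2_module vscale V act" "\<exists>w. sl2_module.standard_basis vscale V act d w"
proof -
  have irr: "irreducible_lie_module sl2_scale sl2_bracket vscale V act"
    and dim: "vector_space.dim vscale V = d + 1"
    using assms by (auto simp: is_sl2_V_def)
  show sl2: "sl2_module vscale V act"
    using irr by (simp add: irreducible_lie_module_def sl2_module_def)
  interpret sl2_module vscale V act by (rule sl2)
  \<comment> \<open>Induction on the degree of p: splitting off a root yields an eigenvector or
    leaves an annihilating polynomial of smaller degree, and a nonzero constant cannot annihilate v
    \<noteq> 0.\<close>
  have eigen: "\<exists>u \<mu>. u \<in> V \<and> u \<noteq> 0 \<and> h u = vscale \<mu> u"
    if "v \<in> V" "v \<noteq> 0" "p \<noteq> 0" "poly_h p v = 0" for p v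
    using that
  proof (induction "degree p" arbitrary: p)
    case 0
    then obtain c where "p = [:c:]" by (metis degree_0_id)
    with 0 show ?case by (simp add: poly_h_def)
  next
    case (Suc n)
    then obtain \<mu> where "poly p \<mu> = 0"
      using alg_closed_imp_poly_has_root by (metis zero_less_Suc)
    then obtain q where q: "p = [:- \<mu>, 1:] * q"
      using poly_eq_0_iff_dvd by blast
    then have "q \<noteq> 0" using Suc.prems by auto
    then have "degree q = n"
      using Suc.hyps(2) by (simp add: q degree_mult_eq del: mult_pCons_left)
    show ?case
    proof (cases "poly_h q v = 0")
      case True
      show ?thesis
        by (rule Suc.hyps(1) [of q]) (use True Suc.prems \<open>degree q = n\<close> \<open>q \<noteq> 0\<close> in auto)
    next
      case False
      moreover have "h (poly_h q v) = vscale \<mu> (poly_h q v)"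
        using poly_h_linear_factor [OF Suc.prems(1), of \<mu> q] Suc.prems(4) by (simp add: q)
      ultimately show ?thesis using poly_h_in_W [OF Suc.prems(1)] by blast
    qed
  qed
  obtain v where v: "v \<in> V" "v \<noteq> 0"
    using irr zero_in_W by (auto simp: irreducible_lie_module_def)
  have "V.dim V > 0" using dim by simp
  then obtain T where T: "finite T" "card T = V.dim V" "V \<subseteq> V.span T"
    by (rule V.finite_dim_spanning_set)
  then have "card T \<le> d + 1" using dim by simp
  have "(h ^^ k) v \<in> V.span T" for k
    using T(3) h_power_in_W [OF v(1)] by blast
  then obtain c where c: "(\<Sum>k\<le>d + 1. vscale (c k) ((h ^^ k) v)) = 0" "\<exists>k\<le>d + 1. c k \<noteq> 0"
    by (rule V.linear_relation_exists [OF T(1) \<open>card T \<le> d + 1\<close>])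
  define p where "p = (\<Sum>k\<le>d + 1. monom (c k) k)"
  have coeff_p: "coeff p k = (if k \<le> d + 1 then c k else 0)" for k
    by (simp add: p_def coeff_sum del: sum.atMost_Suc)
  have "degree p \<le> d + 1"
    by (rule degree_le) (simp add: coeff_p)
  then have "poly_h p v = 0"
    using c(1) by (simp add: poly_h_eq_sum [of p "d + 1"] coeff_p del: sum.atMost_Suc)
  moreover have "p \<noteq> 0"
    using c(2) coeff_p by (metis coeff_0)
  ultimately obtain u \<mu> where "u \<in> V" "u \<noteq> 0" "h u = vscale \<mu> u"
    using eigen v by blast
  then show "\<exists>w. standard_basis d w"
    using irreducible_standard_basis [OF irr dim] by blast
qed

section \<open>Derivations and homogeneous polynomials\<close>

lemma poly_scale_mult:
  "poly_scale c p * q = poly_scale c (p * q)" "p * poly_scale c q = poly_scale c (p * q)"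
  by (simp_all add: poly_scale_def)

lemma vector_space_poly_scale: "vector_space (poly_scale :: 'k::field \<Rightarrow> _)"
proof
  fix a b :: 'k and p q :: "'k poly poly"
  have "[:a + b:] = [:a:] + [:b:]" by simp
  then show "poly_scale (a + b) p = poly_scale a p + poly_scale b p"
    by (simp only: poly_scale_def smult_add_left)
qed (simp_all add: poly_scale_def smult_add_right mult.commute flip: one_pCons)

interpretation poly_scale: vector_space poly_scale
  by (rule vector_space_poly_scale)

definition derivation :: "('k::field poly poly \<Rightarrow> 'k poly poly) \<Rightarrow> bool" where
  "derivation D \<longleftrightarrow> (\<forall>p q. D (p + q) = D p + D q) \<and>
    (\<forall>c p. D (poly_scale c p) = poly_scale c (D p)) \<and> (\<forall>p q. D (p * q) = D p * q + p * D q)"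

lemma derivationD:
  assumes "derivation D"
  shows "D (p + q) = D p + D q" "D (poly_scale c p) = poly_scale c (D p)"
    "D (p * q) = D p * q + p * D q"
  using assms unfolding derivation_def by blast+

lemma derivation_one:
  assumes "derivation D"
  shows "D 1 = 0"
proof -
  have "D 1 + 0 = D 1 + D 1"
    using derivationD(3) [OF assms, of 1 1] by (simp only: mult_1_left mult_1_right add_0_right)
  then show ?thesis by (simp only: add_left_cancel)
qed

text \<open>Two Horner inductions, first over the inner polynomials in z_0, then over the outer
  variable z_1; constants go to 0 because D 1 = 0.\<close>

lemma derivation_eqI:
  assumes D: "derivation D" "derivation D'"
    and "D [:[:0, 1:]:] = D' [:[:0, 1:]:]" "D [:0, 1:] = D' [:0, 1:]"
  shows "D = D'"
proof
  have inner: "D [:q:] = D' [:q:]" for q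
  proof (induction q)
    case 0
    then show ?case using derivationD(2) [OF D(1), of 0 0] derivationD(2) [OF D(2), of 0 0] by simp
  next
    case (pCons c q)
    have "[:pCons c q:] = poly_scale c 1 + [:[:0, 1:]:] * [:q:]"
      by (simp add: poly_scale_def one_pCons)
    then show ?case
      using pCons assms by (simp only: derivationD [OF D(1)] derivationD [OF D(2)] derivation_one)
  qed
  show "D p = D' p" for p
  proof (induction p)
    case 0
    then show ?case using inner [of 0] by simp
  next
    case (pCons q p)
    have "pCons q p = [:q:] + [:0, 1:] * p" by simp
    then show ?case
      using pCons assms inner by (simp only: derivationD [OF D(1)] derivationD [OF D(2)])
  qed
qed

lemma derivation_add: "derivation D \<Longrightarrow> derivation D' \<Longrightarrow> derivation (\<lambda>p. D p + D' p)"
  by (auto simp: derivation_def algebra_simps poly_scale_mult)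

lemma derivation_mult: "derivation D \<Longrightarrow> derivation (\<lambda>p. r * D p)"
  by (auto simp: derivation_def algebra_simps poly_scale_mult)

lemma derivation_scale: "derivation D \<Longrightarrow> derivation (\<lambda>p. poly_scale c (D p))"
  by (auto simp: derivation_def algebra_simps poly_scale_mult)

lemma derivation_commutator:
  assumes "derivation D" "derivation D'"
  shows "derivation (\<lambda>p. D (D' p) - D' (D p))"
  unfolding derivation_def
  by (auto simp: derivationD [OF assms(1)] derivationD [OF assms(2)] algebra_simps)

lemma derivation_pderiv: "derivation pderiv"
  by (auto simp: derivation_def pderiv_add pderiv_smult pderiv_mult poly_scale_def)

lemma pderiv_sum: "pderiv (\<Sum>i\<in>S. p i) = (\<Sum>i\<in>S. pderiv (p i))"
  by (induction S rule: infinite_finite_induct) (simp_all add: pderiv_add)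

lemma derivation_map_poly_pderiv: "derivation (map_poly (pderiv :: 'k::field poly \<Rightarrow> _))"
  unfolding derivation_def
proof (intro conjI allI)
  fix p q :: "'k poly poly" and c
  show "map_poly pderiv (p + q) = map_poly pderiv p + map_poly pderiv q"
    by (rule poly_eqI) (simp add: coeff_map_poly pderiv_add)
  show "map_poly pderiv (poly_scale c p) = poly_scale c (map_poly pderiv p)"
    by (rule poly_eqI) (simp add: coeff_map_poly poly_scale_def pderiv_smult)
  show "map_poly pderiv (p * q) = map_poly pderiv p * q + p * map_poly pderiv q"
    by (rule poly_eqI)
      (simp add: coeff_map_poly coeff_mult pderiv_sum pderiv_mult sum.distrib,
        simp add: mult.commute add.commute)
qed

text \<open>\<open>map_poly pderiv\<close> differentiates in z_0 and \<open>pderiv\<close> in z_1,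
  so this is the derivation sending z_0 to \<open>A\<close> and z_1 to \<open>B\<close>.\<close>

definition poly_der :: "'k::field poly poly \<Rightarrow> 'k poly poly \<Rightarrow> 'k poly poly \<Rightarrow> 'k poly poly" where
  "poly_der A B p = A * map_poly pderiv p + B * pderiv p"

lemma derivation_poly_der: "derivation (poly_der A B)"
  unfolding poly_der_def
  by (intro derivation_add derivation_mult derivation_pderiv derivation_map_poly_pderiv)

lemma poly_der_indeterminates:
  fixes A B :: "'a::field poly poly"
  shows "poly_der A B [:[:0, 1:]:] = A" "poly_der A B [:0, 1:] = B"
proof -
  have "map_poly pderiv 1 = (0 :: 'a poly poly)" by (simp add: one_pCons map_poly_pCons)
  then show "poly_der A B [:[:0, 1:]:] = A" "poly_der A B [:0, 1:] = B"
    by (simp_all add: poly_der_def map_poly_pCons pderiv_pCons flip: one_pCons)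
qed

section \<open>Homogeneous polynomials\<close>

lemma homogeneous_polysI:
  "(\<And>m n. coeff (coeff p n) m \<noteq> 0 \<Longrightarrow> m + n = d) \<Longrightarrow> p \<in> homogeneous_polys d"
  by (simp add: homogeneous_polys_def)

lemma homogeneous_polysD: "p \<in> homogeneous_polys d \<Longrightarrow> coeff (coeff p n) m \<noteq> 0 \<Longrightarrow> m + n = d"
  by (simp add: homogeneous_polys_def)

lemma subspace_homogeneous_polys: "poly_scale.subspace (homogeneous_polys d)"
  unfolding poly_scale.subspace_def homogeneous_polys_def
  by (auto simp: poly_scale_def) (metis add.right_neutral)

lemma homogeneous_polys_mult:
  assumes "p \<in> homogeneous_polys c" "q \<in> homogeneous_polys d"
  shows "p * q \<in> homogeneous_polys (c + d)"
proof (rule homogeneous_polysI)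
  fix m n
  assume "coeff (coeff (p * q) n) m \<noteq> 0"
  then have "(\<Sum>i\<le>n. \<Sum>j\<le>m. coeff (coeff p i) j * coeff (coeff q (n - i)) (m - j)) \<noteq> 0"
    by (simp add: coeff_mult coeff_sum)
  then obtain i where "i \<le> n" "(\<Sum>j\<le>m. coeff (coeff p i) j * coeff (coeff q (n - i)) (m - j)) \<noteq> 0"
    by (metis (no_types, lifting) atMost_iff sum.neutral)
  moreover from this(2) obtain j where "j \<le> m" "coeff (coeff p i) j * coeff (coeff q (n - i)) (m - j) \<noteq> 0"
    by (metis (no_types, lifting) atMost_iff sum.neutral)
  ultimately show "m + n = c + d"
    using homogeneous_polysD [OF assms(1), of i j] homogeneous_polysD [OF assms(2), of "n - i" "m - j"]
    by auto
qed

lemma homogeneous_polys_one: "1 \<in> homogeneous_polys 0"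
  by (rule homogeneous_polysI) (auto simp: one_pCons coeff_pCons split: nat.splits)

lemma homogeneous_polys_power: "p \<in> homogeneous_polys 1 \<Longrightarrow> p ^ n \<in> homogeneous_polys n"
proof (induction n)
  case (Suc n)
  then show ?case using homogeneous_polys_mult [of p 1 "p ^ n" n] by simp
qed (simp add: homogeneous_polys_one)

text \<open>Each partial derivative lowers the degree by one and the linear factor restores it; d
  \<ge> 1 makes 1 + (d - 1) = d hold in the natural numbers.\<close>

lemma homogeneous_polys_poly_der:
  assumes "A \<in> homogeneous_polys 1" "B \<in> homogeneous_polys 1" "p \<in> homogeneous_polys d" "d \<ge> 1"
  shows "poly_der A B p \<in> homogeneous_polys d"
proof -
  have "map_poly pderiv p \<in> homogeneous_polys (d - 1)"
  proof (rule homogeneous_polysI)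
    fix m n assume "coeff (coeff (map_poly pderiv p) n) m \<noteq> 0"
    then have "coeff (coeff p n) (Suc m) \<noteq> 0" by (auto simp: coeff_map_poly coeff_pderiv)
    then show "m + n = d - 1" using homogeneous_polysD [OF assms(3)] by fastforce
  qed
  then have A: "A * map_poly pderiv p \<in> homogeneous_polys d"
    using homogeneous_polys_mult [OF assms(1)] assms(4) by fastforce
  have "pderiv p \<in> homogeneous_polys (d - 1)"
  proof (rule homogeneous_polysI)
    fix m n assume "coeff (coeff (pderiv p) n) m \<noteq> 0"
    then have "coeff (coeff p (Suc n)) m \<noteq> 0"
      by (auto simp: coeff_pderiv of_nat_poly)
    then show "m + n = d - 1" using homogeneous_polysD [OF assms(3)] by fastforce
  qed
  then have B: "B * pderiv p \<in> homogeneous_polys d"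
    using homogeneous_polys_mult [OF assms(2)] assms(4) by fastforce
  show ?thesis
    unfolding poly_der_def by (rule poly_scale.subspace_add [OF subspace_homogeneous_polys A B])
qed

text \<open>The monomials of degree d. Only an upper bound on the dimension is recorded; the
  matching independence comes from the distinct weights in the f-string of z_1^d.\<close>

lemma homogeneous_polys_spanning_set:
  obtains T :: "'k::field poly poly set"
  where "finite T" "card T \<le> Suc d" "homogeneous_polys d \<subseteq> poly_scale.span T"
proof
  let ?mon = "\<lambda>n. monom (monom 1 (d - n)) n :: 'k poly poly"
  show "finite (?mon ` {..d})" by simp
  show "card (?mon ` {..d}) \<le> Suc d" using card_image_le [of "{..d}" ?mon] by simp
  show "homogeneous_polys d \<subseteq> poly_scale.span (?mon ` {..d})"
  proof
    fix p :: "'k poly poly" assume p: "p \<in> homogeneous_polys d"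
    have eq: "p = (\<Sum>n\<le>d. poly_scale (coeff (coeff p n) (d - n)) (?mon n))"
    proof (intro poly_eqI)
      fix n m
      have "coeff (coeff (\<Sum>n\<le>d. poly_scale (coeff (coeff p n) (d - n)) (?mon n)) n) m
          = (\<Sum>k\<le>d. if k = n then (if d - n = m then coeff (coeff p n) (d - n) else 0) else 0)"
        unfolding coeff_sum by (intro sum.cong) (simp_all add: poly_scale_def)
      also have "\<dots> = coeff (coeff p n) m"
      proof -
        have "coeff (coeff p n) m = 0 \<or> m + n = d" "coeff (coeff p n) (d - n) = 0 \<or> n \<le> d"
          using homogeneous_polysD [OF p] by fastforce+
        then show ?thesis by auto
      qed
      finally show "coeff (coeff p n) m
        = coeff (coeff (\<Sum>n\<le>d. poly_scale (coeff (coeff p n) (d - n)) (?mon n)) n) m" ..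
    qed
    show "p \<in> poly_scale.span (?mon ` {..d})"
      by (subst eq) (intro poly_scale.span_sum poly_scale.span_scale poly_scale.span_base imageI)
  qed
qed

lemma derivation_power_eigenvector:
  assumes D: "derivation D" "D p = poly_scale c p"
  shows "D (p ^ n) = poly_scale (of_nat n * c) (p ^ n)"
proof (induction n)
  case (Suc n)
  have "D (p ^ Suc n) = poly_scale c (p ^ Suc n) + poly_scale (of_nat n * c) (p ^ Suc n)"
    by (simp only: power_Suc derivationD [OF D(1)] D(2) Suc poly_scale_mult)
  also have "\<dots> = poly_scale (of_nat (Suc n) * c) (p ^ Suc n)"
    unfolding poly_scale.scale_left_distrib [symmetric] by (simp add: distrib_right)
  finally show ?case .
qed (simp add: derivation_one [OF D(1)])

section \<open>The polynomial module\<close>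

lemma sum_index4:
  fixes g :: "4 \<Rightarrow> 'a::comm_monoid_add"
  assumes "distinct [i, j, k, l]"
  shows "sum g UNIV = g i + g j + g k + g l"
proof -
  have "card {i, j, k, l} = CARD(4)" using assms by simp
  then have "UNIV = {i, j, k, l}" by (intro card_subset_eq [symmetric]) auto
  then have "sum g UNIV = sum g {i, j, k, l}" by (rule arg_cong)
  then show ?thesis using assms by (simp add: add.assoc)
qed

text \<open>Substituting \<open>v\<close> from the first relation into the second leaves one
  equation for \<open>u\<close> with coefficient \<open>b\<^sub>2 - b\<^sub>3\<close>. As an
  equivalence it yields both existence and uniqueness of z_2 and z_3.\<close>

lemma poly_relations_solution:
  fixes x y u v :: "'k::field poly poly"
  assumes "b\<^sub>2 \<noteq> b\<^sub>3"
  shows "x + y + u + v = 0 \<and>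
      poly_scale b\<^sub>0 x + poly_scale b\<^sub>1 y + poly_scale b\<^sub>2 u + poly_scale b\<^sub>3 v = 0 \<longleftrightarrow>
    u = poly_scale (inverse (b\<^sub>2 - b\<^sub>3)) (poly_scale (b\<^sub>3 - b\<^sub>0) x + poly_scale (b\<^sub>3 - b\<^sub>1) y) \<and>
    v = - (x + y + u)"
proof -
  let ?w = "poly_scale (b\<^sub>3 - b\<^sub>0) x + poly_scale (b\<^sub>3 - b\<^sub>1) y"
  have "x + y + u + v = 0 \<longleftrightarrow> v = - (x + y + u)"
    by (simp only: eq_neg_iff_add_eq_0 add.commute [of v])
  moreover have "poly_scale b\<^sub>0 x + poly_scale b\<^sub>1 y + poly_scale b\<^sub>2 u + poly_scale b\<^sub>3 (- (x + y + u))
      = poly_scale (b\<^sub>2 - b\<^sub>3) u - ?w"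
    by (simp add: poly_scale.scale_left_diff_distrib poly_scale.scale_right_distrib
        poly_scale.scale_right_diff_distrib)
  moreover have "poly_scale (b\<^sub>2 - b\<^sub>3) u - ?w = 0 \<longleftrightarrow> u = poly_scale (inverse (b\<^sub>2 - b\<^sub>3)) ?w"
  proof
    assume "poly_scale (b\<^sub>2 - b\<^sub>3) u - ?w = 0"
    then have "?w = poly_scale (b\<^sub>2 - b\<^sub>3) u" by simp
    then show "u = poly_scale (inverse (b\<^sub>2 - b\<^sub>3)) ?w"
      using assms by (simp only: poly_scale.scale_scale) simp
  next
    assume u: "u = poly_scale (inverse (b\<^sub>2 - b\<^sub>3)) ?w"
    show "poly_scale (b\<^sub>2 - b\<^sub>3) u - ?w = 0"
      unfolding u poly_scale.scale_scale using assms by simp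
  qed
  ultimately show ?thesis by auto
qed

lemma poly_z:
  fixes \<beta> :: "4 \<Rightarrow> 'k::field"
  assumes "inj \<beta>"
  shows poly_z_0: "poly_z \<beta> 0 = [:[:0, 1:]:]" and poly_z_1: "poly_z \<beta> 1 = [:0, 1:]"
    and sum_poly_z: "(\<Sum>i\<in>UNIV. poly_z \<beta> i) = 0"
    and sum_scaled_poly_z: "(\<Sum>i\<in>UNIV. poly_scale (\<beta> i) (poly_z \<beta> i)) = 0"
proof -
  have \<beta>: "\<beta> 2 - \<beta> 3 \<noteq> 0" using inj_eq [OF assms, of 2 3] by simp
  have sum4: "sum g UNIV = g 0 + g 1 + g 2 + g 3" for g :: "4 \<Rightarrow> 'k poly poly"
    by (rule sum_index4) simp
  let ?x = "[:[:0, 1:]:] :: 'k poly poly" and ?y = "[:0, 1:] :: 'k poly poly"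
  let ?P = "\<lambda>\<zeta> :: 4 \<Rightarrow> 'k poly poly. \<zeta> 0 = ?x \<and> \<zeta> 1 = ?y \<and>
     (\<Sum>i\<in>UNIV. \<zeta> i) = 0 \<and> (\<Sum>i\<in>UNIV. poly_scale (\<beta> i) (\<zeta> i)) = 0"
  define z2 where "z2 = poly_scale (inverse (\<beta> 2 - \<beta> 3))
    (poly_scale (\<beta> 3 - \<beta> 0) ?x + poly_scale (\<beta> 3 - \<beta> 1) ?y)"
  have z2: "?x + ?y + u + v = 0 \<and> poly_scale (\<beta> 0) ?x + poly_scale (\<beta> 1) ?y
      + poly_scale (\<beta> 2) u + poly_scale (\<beta> 3) v = 0 \<longleftrightarrow> u = z2 \<and> v = - (?x + ?y + u)" for u v
    unfolding z2_def by (rule poly_relations_solution) (use \<beta> in simp)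
  let ?\<zeta> = "\<lambda>i. if i = 0 then ?x else if i = 1 then ?y else if i = 2 then z2 else - (?x + ?y + z2)"
  have "?P ?\<zeta>" using z2 [of z2 "- (?x + ?y + z2)"] by (simp add: sum4)
  moreover have "\<zeta> = ?\<zeta>" if "?P \<zeta>" for \<zeta>
  proof
    fix i
    show "\<zeta> i = ?\<zeta> i"
      using that z2 [of "\<zeta> 2" "\<zeta> 3"] index4_cases [of i] by (auto simp: sum4)
  qed
  ultimately have "?P (poly_z \<beta>)"
    unfolding poly_z_def by (rule theI)
  then show "poly_z \<beta> 0 = ?x" "poly_z \<beta> 1 = ?y" "(\<Sum>i\<in>UNIV. poly_z \<beta> i) = 0"
    "(\<Sum>i\<in>UNIV. poly_scale (\<beta> i) (poly_z \<beta> i)) = 0"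
    by blast+
qed

text \<open>Subtracting \<open>\<beta> l\<close> times the first defining relation from the second
  eliminates z_l. Hence any two of the z_i span all four.\<close>

lemma poly_z_relation:
  fixes \<beta> :: "4 \<Rightarrow> 'k::field"
  assumes "inj \<beta>" "distinct [i, j, k, l]"
  shows "poly_z \<beta> k = poly_scale ((\<beta> i - \<beta> l) / (\<beta> l - \<beta> k)) (poly_z \<beta> i)
    + poly_scale ((\<beta> j - \<beta> l) / (\<beta> l - \<beta> k)) (poly_z \<beta> j)"
proof -
  let ?z = "poly_z \<beta>"
  have \<beta>: "\<beta> l - \<beta> k \<noteq> 0" using inj_eq [OF assms(1), of l k] assms(2) by auto
  have sums: "?z i + ?z j + ?z k + ?z l = 0"
    "poly_scale (\<beta> i) (?z i) + poly_scale (\<beta> j) (?z j) + poly_scale (\<beta> k) (?z k)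
      + poly_scale (\<beta> l) (?z l) = 0"
    using sum_poly_z [OF assms(1)] sum_scaled_poly_z [OF assms(1)]
    by (simp_all only: sum_index4 [OF assms(2)])
  have l: "?z l = - (?z i + ?z j + ?z k)"
    using sums(1) by (simp only: eq_neg_iff_add_eq_0 add.commute)
  have "poly_scale (\<beta> l - \<beta> k) (?z k)
      = poly_scale (\<beta> i - \<beta> l) (?z i) + poly_scale (\<beta> j - \<beta> l) (?z j)"
    using sums(2) unfolding l
    by (simp only: poly_scale.scale_left_diff_distrib poly_scale.scale_minus_right poly_scale.scale_right_distrib)
      (simp add: algebra_simps)
  then have "poly_scale (inverse (\<beta> l - \<beta> k)) (poly_scale (\<beta> l - \<beta> k) (?z k))
    = poly_scale (inverse (\<beta> l - \<beta> k)) (poly_scale (\<beta> i - \<beta> l) (?z i) + poly_scale (\<beta> j - \<beta> l) (?z j))"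
    by (rule arg_cong)
  then show ?thesis
    using \<beta> by (simp add: poly_scale.scale_right_distrib divide_inverse mult.commute)
qed

text \<open>The module conditions prescribe x_ij on z_i and z_j only. By
  \<open>poly_z_relation\<close> these two span every other z_k, in particular the indeterminates
  z_0 and z_1.\<close>

lemma derivation_eqI_poly_z:
  fixes \<beta> :: "4 \<Rightarrow> 'k::field"
  assumes "inj \<beta>" and D: "derivation D" "derivation D'" and "i \<noteq> j"
    and ij: "D (poly_z \<beta> i) = D' (poly_z \<beta> i)" "D (poly_z \<beta> j) = D' (poly_z \<beta> j)"
  shows "D = D'"
proof -
  have all: "D (poly_z \<beta> k) = D' (poly_z \<beta> k)" for k
  proof (cases "k = i \<or> k = j")
    case False
    have "card {i, j, k} < CARD(4)" using card_insert_le_m1 [of 3 "{j, k}" i] by (simp add: card_insert_if)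
    then have "{i, j, k} \<noteq> UNIV" by (metis less_irrefl)
    then obtain l where "l \<notin> {i, j, k}" by blast
    with False \<open>i \<noteq> j\<close> have "distinct [i, j, k, l]" by auto
    from poly_z_relation [OF assms(1) this] show ?thesis
      by (simp only: derivationD [OF D(1)] derivationD [OF D(2)] ij)
  qed (use ij in auto)
  show ?thesis
    by (rule derivation_eqI [OF D]) (use all [of 0] all [of 1] in \<open>simp_all only: poly_z_0 poly_z_1 assms\<close>)
qed

section \<open>The action of sl_2 on polynomials by derivations\<close>

locale tetra_poly_module =
  fixes \<beta> :: "4 \<Rightarrow> 'k::field_char_0"
  assumes inj_\<beta>: "inj \<beta>"
begin

lemma \<beta>_neq [simp]: "i \<noteq> j \<Longrightarrow> \<beta> i \<noteq> \<beta> j"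
  using inj_\<beta> by (simp add: inj_eq)

abbreviation z where "z \<equiv> poly_z \<beta>"

definition s where "s = (\<beta> 1 - \<beta> 0) / (\<beta> 3 - \<beta> 0)"
definition t where "t = (\<beta> 3 - \<beta> 0) / (\<beta> 1 - \<beta> 0)"
definition a where "a = (\<beta> 0 - \<beta> 1) / (\<beta> 0 - \<beta> 3) * ((\<beta> 2 - \<beta> 3) / (\<beta> 2 - \<beta> 1))"

lemma s_t: "s * t = 1"
  by (simp add: s_def t_def)

lemma a_neq: "a \<noteq> 0" "a \<noteq> 1"
proof -
  \<comment> \<open>The numerator of \<open>a\<close> minus its denominator is a product of nonzero
    differences, which excludes \<open>a = 1\<close>.\<close>
  have "(\<beta> 0 - \<beta> 1) * (\<beta> 2 - \<beta> 3) - (\<beta> 0 - \<beta> 3) * (\<beta> 2 - \<beta> 1) = (\<beta> 0 - \<beta> 2) * (\<beta> 1 - \<beta> 3)"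
    by (simp add: algebra_simps)
  moreover have "(\<beta> 0 - \<beta> 2) * (\<beta> 1 - \<beta> 3) \<noteq> 0" by simp
  ultimately have "(\<beta> 0 - \<beta> 1) * (\<beta> 2 - \<beta> 3) \<noteq> (\<beta> 0 - \<beta> 3) * (\<beta> 2 - \<beta> 1)" by auto
  then show "a \<noteq> 1" by (simp add: a_def)
qed (simp add: a_def)

definition z_comb where "z_comb x y = poly_scale x (z 1) + poly_scale y (z 3)"

text \<open>\<open>coord1\<close> and \<open>coord3\<close> are the coordinates of z_i in the basis
  z_1, z_3; the values at 0 and 2 are those of \<open>poly_z_relation\<close>.\<close>

definition coord1 where "coord1 (i :: 4) =
  (if i = 0 then (\<beta> 1 - \<beta> 2) / (\<beta> 2 - \<beta> 0) else if i = 1 then 1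
   else if i = 2 then (\<beta> 1 - \<beta> 0) / (\<beta> 0 - \<beta> 2) else 0)"
definition coord3 where "coord3 (i :: 4) =
  (if i = 0 then (\<beta> 3 - \<beta> 2) / (\<beta> 2 - \<beta> 0) else if i = 1 then 0
   else if i = 2 then (\<beta> 3 - \<beta> 0) / (\<beta> 0 - \<beta> 2) else 1)"

lemma z_eq_comb: "z i = z_comb (coord1 i) (coord3 i)"
  using index4_cases [of i] poly_z_relation [OF inj_\<beta>, of 1 3 0 2]
    poly_z_relation [OF inj_\<beta>, of 1 3 2 0]
  by (auto simp: z_comb_def coord1_def coord3_def)

lemma z_comb_simps:
  "z_comb x y + z_comb x' y' = z_comb (x + x') (y + y')"
  "z_comb x y - z_comb x' y' = z_comb (x - x') (y - y')"
  "- z_comb x y = z_comb (- x) (- y)"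
  "poly_scale c (z_comb x y) = z_comb (c * x) (c * y)"
  by (simp_all add: z_comb_def poly_scale.scale_left_distrib poly_scale.scale_left_diff_distrib
      poly_scale.scale_right_distrib)

lemma coord3_0: "coord3 0 \<noteq> 0"
  by (simp add: coord3_def)

text \<open>\<open>w1\<close> and \<open>w3\<close> are the prescribed images of \<open>z 1\<close> and \<open>z 3\<close>, from which the image of the
  indeterminate \<open>z 0\<close> follows by linearity.\<close>

definition sl2_act where
  "sl2_act u = (case u of (p, q, r) \<Rightarrow>
    let w1 = z_comb r (q * t); w3 = z_comb (p * s) (- r)
    in poly_der (poly_scale (coord1 0) w1 + poly_scale (coord3 0) w3) w1)"

lemma derivation_sl2_act: "derivation (sl2_act u)"
  by (simp add: sl2_act_def Let_def derivation_poly_der split: prod.split)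

lemma sl2_act_z_comb:
  "sl2_act (p, q, r) (z_comb x y) = z_comb (r * x + p * (s * y)) (q * (t * x) - r * y)"
proof -
  let ?D = "sl2_act (p, q, r)" and ?w1 = "z_comb r (q * t)" and ?w3 = "z_comb (p * s) (- r)"
  note D = derivationD [OF derivation_sl2_act [of "(p, q, r)"]]
  have 1: "?D (z 1) = ?w1"
    by (simp add: sl2_act_def Let_def poly_z_1 [OF inj_\<beta>] poly_der_indeterminates)
  have "?D (z 0) = poly_scale (coord1 0) ?w1 + poly_scale (coord3 0) ?w3"
    by (simp add: sl2_act_def Let_def poly_z_0 [OF inj_\<beta>] poly_der_indeterminates)
  \<comment> \<open>\<open>poly_der\<close> fixes the images of z_0 and z_1. As z_0 has a nonzero
    coordinate along z_3, the image of z_3 follows by cancelling.\<close>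
  then have "poly_scale (coord3 0) (?D (z 3)) = poly_scale (coord3 0) ?w3"
    unfolding z_eq_comb [of 0] unfolding z_comb_def [of "coord1 0"] D 1 by (simp only: add_left_cancel)
  then have 3: "?D (z 3) = ?w3"
    using coord3_0 by (simp only: poly_scale.scale_cancel_left) simp
  show ?thesis
    unfolding z_comb_def [of x y] D 1 3 z_comb_simps by (simp add: algebra_simps)
qed

lemma derivation_eqI_z_comb:
  assumes "derivation D" "derivation D'" "\<And>x y. D (z_comb x y) = D' (z_comb x y)"
  shows "D = D'"
  by (rule derivation_eqI_poly_z [OF inj_\<beta> assms(1,2), of 1 3])
    (simp_all only: z_eq_comb assms(3), simp)

text \<open>In each axiom concerning the Lie algebra argument both sides are derivations, so
  comparing them on linear forms suffices. There the action is by 2 by 2 matrices, and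
  \<open>s * t = 1\<close> gives [e, f] = h.\<close>

lemma lie_module_sl2_act: "lie_module sl2_scale sl2_bracket poly_scale UNIV sl2_act"
proof (intro lie_module.intro lie_module_axioms.intro)
  fix u v :: "'k sl2" and c p q
  note D = derivation_sl2_act
  obtain p1 p2 p3 where u: "u = (p1, p2, p3)" by (cases u)
  obtain q1 q2 q3 where v: "v = (q1, q2, q3)" by (cases v)
  have "sl2_act (u + v) = (\<lambda>p. sl2_act u p + sl2_act v p)"
    by (rule derivation_eqI_z_comb) (auto simp: D derivation_add u v sl2_act_z_comb z_comb_simps algebra_simps)
  then show "sl2_act (u + v) p = sl2_act u p + sl2_act v p" by metis
  have "sl2_act (sl2_scale c u) = (\<lambda>p. poly_scale c (sl2_act u p))"
    by (rule derivation_eqI_z_comb) (auto simp: D derivation_scale u sl2_act_z_comb z_comb_simps algebra_simps)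
  then show "sl2_act (sl2_scale c u) p = poly_scale c (sl2_act u p)" by metis
  have "sl2_act (sl2_bracket u v) = (\<lambda>p. sl2_act u (sl2_act v p) - sl2_act v (sl2_act u p))"
  proof (rule derivation_eqI_z_comb)
    fix x y
    have 1: "s * (t * r) = r" for r using s_t by (simp flip: mult.assoc)
    have 2: "t * (s * r) = r" for r using 1 by (simp add: mult.left_commute)
    show "sl2_act (sl2_bracket u v) (z_comb x y)
        = sl2_act u (sl2_act v (z_comb x y)) - sl2_act v (sl2_act u (z_comb x y))"
      unfolding u v sl2_bracket.simps sl2_act_z_comb z_comb_simps
      by (rule arg_cong2 [where f = z_comb]) (simp_all add: algebra_simps 1 2 s_t)
  qed (auto simp: D derivation_commutator)
  then show "sl2_act (sl2_bracket u v) p = sl2_act u (sl2_act v p) - sl2_act v (sl2_act u p)" by metis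
  show "sl2_act u (p + q) = sl2_act u p + sl2_act u q"
    "sl2_act u (poly_scale c p) = poly_scale c (sl2_act u p)"
    by (rule derivationD [OF D])+
qed (simp_all add: sl2_lie_algebra vector_space_poly_scale)

lemma sl2_act_EV_gen:
  assumes "i \<noteq> j"
  shows "sl2_act (EV_gen a i j) (z i) = - z i" "sl2_act (EV_gen a i j) (z j) = z j"
proof -
  define b c where "b = inverse a" and "c = inverse (1 - a)"
  define \<alpha> \<gamma> \<alpha>' \<gamma>' where "\<alpha> = coord1 0" and "\<gamma> = coord3 0" and "\<alpha>' = coord1 2" and "\<gamma>' = coord3 2"
  define A B C D E where "A = \<beta> 0 - \<beta> 1" and "B = \<beta> 0 - \<beta> 3" and "C = \<beta> 2 - \<beta> 1"
    and "D = \<beta> 2 - \<beta> 3" and "E = \<beta> 2 - \<beta> 0"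
  then have neq: "A \<noteq> 0" "B \<noteq> 0" "C \<noteq> 0" "D \<noteq> 0" "E \<noteq> 0"
    and diffs: "\<beta> 0 - \<beta> 1 = A" "\<beta> 0 - \<beta> 3 = B" "\<beta> 2 - \<beta> 1 = C" "\<beta> 2 - \<beta> 3 = D" "\<beta> 2 - \<beta> 0 = E"
      "\<beta> 1 - \<beta> 0 = - A" "\<beta> 3 - \<beta> 0 = - B" "\<beta> 1 - \<beta> 2 = - C" "\<beta> 3 - \<beta> 2 = - D" "\<beta> 0 - \<beta> 2 = - E"
    by auto
  have param: "s = A / B" "t = B / A" "a = A / B * (D / C)"
      "\<alpha> = - C / E" "\<gamma> = - D / E" "\<alpha>' = A / E" "\<gamma>' = B / E"
    unfolding s_def t_def a_def \<alpha>_def \<gamma>_def \<alpha>'_def \<gamma>'_def coord1_def coord3_def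
    by (simp_all add: diffs)
  \<comment> \<open>The \<beta>'s enter the check only through these ratios: z_2 is proportional to
    s z_1 + z_3, and z_0 to s z_1 + a z_3.\<close>
  have "s * \<gamma> = a * \<alpha>" "s * \<gamma>' = \<alpha>'" "t * \<alpha>' = \<gamma>'" "t * \<alpha> = b * \<gamma>"
    unfolding b_def param using neq by (simp_all add: field_simps)
  then have scal: "s * \<gamma> = a * \<alpha>" "s * \<gamma>' = \<alpha>'" "t * \<alpha>' = \<gamma>'" "t * \<alpha> = b * \<gamma>"
    by auto
  have coords: "coord1 0 = \<alpha>" "coord3 0 = \<gamma>" "coord1 2 = \<alpha>'" "coord3 2 = \<gamma>'"
    "coord1 1 = 1" "coord3 1 = 0" "coord1 3 = 0" "coord3 3 = 1"
    by (simp_all add: \<alpha>_def \<gamma>_def \<alpha>'_def \<gamma>'_def coord1_def coord3_def)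
  have pf: "c * a = c - 1" "b * (a * r) = r" "c * (a * r) = c * r - r"
      "b * (c * r) = b * r + c * r" for r
    using partial_fractions [OF a_neq, folded b_def c_def] by (simp_all add: mult.commute [of c a] mult.left_commute [of _ a])
  note gen = EV_gen_def Let_def b_def [symmetric] c_def [symmetric]
  have "sl2_act (EV_gen a i j) (z i) = - z i \<and> sl2_act (EV_gen a i j) (z j) = z j"
    using assms index4_cases [of i] index4_cases [of j]
    by (elim disjE; simp add: gen z_eq_comb coords sl2_act_z_comb z_comb_simps scal;
        (simp add: algebra_simps pf)?)
  then show "sl2_act (EV_gen a i j) (z i) = - z i" "sl2_act (EV_gen a i j) (z j) = z j"
    by auto
qed

text \<open>\<open>poly_act\<close> is a definite description. Any competing action is by
  derivations, so it agrees on each generator by its two prescribed values, and then on all elements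
  by \<open>tetra_induct\<close>.\<close>

lemma poly_act_eq: "poly_act \<beta> u = sl2_act (EV a u)"
proof -
  let ?act = "\<lambda>u. sl2_act (EV a u)"
  let ?P = "\<lambda>act. lie_module tetra_scale tetra_bracket poly_scale UNIV act \<and>
     (\<forall>u p q. act u (p * q) = act u p * q + p * act u q) \<and>
     (\<forall>i j. i \<noteq> j \<longrightarrow> act (tetra_x i j) (z i) = - z i \<and> act (tetra_x i j) (z j) = z j)"
  have mod: "lie_module tetra_scale tetra_bracket poly_scale UNIV ?act"
    by (rule lie_module_pullback [OF lie_hom_EV [OF a_neq] lie_module_sl2_act])
  have "poly_act \<beta> = ?act"
    unfolding poly_act_def
  proof (rule the_equality)
    show "?P ?act"
      using mod derivationD(3) [OF derivation_sl2_act] sl2_act_EV_gen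
      by (auto simp: EV_tetra_x [OF a_neq])
    fix act assume P: "?P act"
    interpret M: lie_module tetra_scale tetra_bracket poly_scale UNIV act using P by blast
    interpret N: lie_module tetra_scale tetra_bracket poly_scale UNIV ?act by (rule mod)
    have der: "derivation (act u)" for u
      unfolding derivation_def using P by (auto simp: M.act_add_right M.act_scale_right)
    have "act u = ?act u" for u
    proof (induction u rule: tetra_induct)
      case (gen i j)
      then show ?case
        using P sl2_act_EV_gen [of i j]
        by (intro derivation_eqI_poly_z [OF inj_\<beta> der derivation_sl2_act gen])
          (simp_all add: EV_tetra_x [OF a_neq])
    next
      case zero
      show ?case using M.act_add_left [of _ 0 0] N.act_add_left [of _ 0 0] by (auto simp: fun_eq_iff)
    next
      case (add u v)
      show ?case
        using M.act_add_left [of _ u v] N.act_add_left [of _ u v] by (auto simp: fun_eq_iff add)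
    next
      case (scale c u)
      show ?case
        using M.act_scale_left [of _ c u] N.act_scale_left [of _ c u] by (auto simp: fun_eq_iff scale)
    next
      case (bracket u v)
      show ?case
        using M.act_bracket [of _ u v] N.act_bracket [of _ u v] by (auto simp: fun_eq_iff bracket)
    qed
    then show "act = ?act" by blast
  qed
  then show ?thesis by simp
qed

lemma z_homogeneous: "z i \<in> homogeneous_polys 1"
proof -
  have 01: "z 0 \<in> homogeneous_polys 1" "z 1 \<in> homogeneous_polys 1"
    by (auto intro!: homogeneous_polysI
        simp: poly_z_0 poly_z_1 inj_\<beta> coeff_pCons one_pCons split: nat.splits if_splits)
  have "z k \<in> homogeneous_polys 1" if "distinct [0, 1, k, l]" for k l
    unfolding poly_z_relation [OF inj_\<beta> that]
    by (intro poly_scale.subspace_add [OF subspace_homogeneous_polys]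
        poly_scale.subspace_scale [OF subspace_homogeneous_polys] 01)
  from this [of 2 3] this [of 3 2] 01 index4_cases [of i] show ?thesis by auto
qed

lemma sl2_act_homogeneous:
  assumes "d \<ge> 1" "p \<in> homogeneous_polys d"
  shows "sl2_act u p \<in> homogeneous_polys d"
proof -
  note sub = subspace_homogeneous_polys
  have "z_comb x y \<in> homogeneous_polys 1" for x y
    unfolding z_comb_def
    by (intro poly_scale.subspace_add [OF sub] poly_scale.subspace_scale [OF sub] z_homogeneous)
  then show ?thesis
    using assms unfolding sl2_act_def Let_def
    by (auto split: prod.split intro!: homogeneous_polys_poly_der poly_scale.subspace_add [OF sub]
        poly_scale.subspace_scale [OF sub])
qed

lemma sl2_module_homogeneous_polys:
  assumes "d \<ge> 1"
  shows "sl2_module poly_scale (homogeneous_polys d) sl2_act"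
proof -
  interpret sl2_module poly_scale UNIV sl2_act
    by (simp add: sl2_module_def lie_module_sl2_act)
  show ?thesis
    unfolding sl2_module_def
    by (rule submodule [OF subspace_homogeneous_polys subset_UNIV sl2_act_homogeneous [OF assms]])
qed

lemma homogeneous_polys_standard_basis:
  assumes "d \<ge> 1"
  shows "\<exists>w. sl2_module.standard_basis poly_scale (homogeneous_polys d) sl2_act d w"
proof -
  interpret sl2_module poly_scale "homogeneous_polys d" sl2_act
    by (rule sl2_module_homogeneous_polys [OF assms])
  obtain T :: "'k poly poly set"
    where T: "finite T" "card T \<le> Suc d" "homogeneous_polys d \<subseteq> poly_scale.span T"
    by (rule homogeneous_polys_spanning_set)
  have z1: "z 1 = z_comb 1 0" by (simp add: z_comb_def)
  have "sl2_act sl2_e (z 1) = poly_scale 0 (z 1)" "sl2_act sl2_h (z 1) = poly_scale 1 (z 1)"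
    unfolding z1 z_comb_simps sl2_e_def sl2_h_def sl2_act_z_comb by simp_all
  then have eh: "sl2_act sl2_e (z 1 ^ d) = 0" "sl2_act sl2_h (z 1 ^ d) = poly_scale (of_nat d) (z 1 ^ d)"
    by (simp_all only: derivation_power_eigenvector [OF derivation_sl2_act]) simp_all
  have "z 1 ^ d \<noteq> 0" by (simp add: poly_z_1 inj_\<beta>)
  from standard_basis_of_highest_weight_vector [OF homogeneous_polys_power [OF z_homogeneous] eh
      HOL.refl this T]
  show ?thesis by blast
qed

end

section \<open>The isomorphism over the tetrahedron algebra\<close>

theorem theorem14p12:
  fixes \<beta> :: "4 \<Rightarrow> 'k::{alg_closed_field, field_char_0}"
    and a :: 'k
    and d :: nat
    and vscale :: "'k \<Rightarrow> 'v::ab_group_add \<Rightarrow> 'v"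
    and V :: "'v set"
    and act :: "'k sl2 \<Rightarrow> 'v \<Rightarrow> 'v"
  assumes "inj \<beta>"
    and "d \<ge> 1"
    and "a = (\<beta> 0 - \<beta> 1) / (\<beta> 0 - \<beta> 3) * ((\<beta> 2 - \<beta> 3) / (\<beta> 2 - \<beta> 1))"
    and "is_sl2_V d vscale V act"
  shows "lie_module_isomorphic tetra_scale tetra_bracket
    poly_scale (homogeneous_polys d) (poly_act \<beta>)
    vscale V (pullback_EV a act)"
proof -
  interpret P: tetra_poly_module \<beta> by standard (rule assms(1))
  have a: "a = P.a" by (simp add: assms(3) P.a_def)
  note EV = lie_hom_EV [OF P.a_neq, folded a]
  \<comment> \<open>Both actions factor through the same homomorphism \<open>EV a\<close>, so an
    isomorphism of sl_2-modules is already one of modules over the tetrahedron algebra.\<close>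
  have act: "poly_act \<beta> = (\<lambda>u. P.sl2_act (EV a u))" "pullback_EV a act = (\<lambda>u. act (EV a u))"
    by (auto simp: P.poly_act_eq a pullback_EV_def)
  note mod1 = P.sl2_module_homogeneous_polys [OF assms(2)]
    and mod2 = sl2_V_standard_basis(1) [OF assms(4)]
  obtain w v where "sl2_module.standard_basis poly_scale (homogeneous_polys d) P.sl2_act d w"
      "sl2_module.standard_basis vscale V act d v"
    using P.homogeneous_polys_standard_basis [OF assms(2)] sl2_V_standard_basis(2) [OF assms(4)]
    by blast
  then obtain \<phi> where "bij_betw \<phi> (homogeneous_polys d) V"
    "\<And>x y. x \<in> homogeneous_polys d \<Longrightarrow> y \<in> homogeneous_polys d \<Longrightarrow> \<phi> (x + y) = \<phi> x + \<phi> y"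
    "\<And>c x. x \<in> homogeneous_polys d \<Longrightarrow> \<phi> (poly_scale c x) = vscale c (\<phi> x)"
    "\<And>u x. x \<in> homogeneous_polys d \<Longrightarrow> \<phi> (P.sl2_act u x) = act u (\<phi> x)"
    by (rule sl2_standard_basis_isomorphism [OF mod1 mod2]) blast
  then show ?thesis
    unfolding lie_module_isomorphic_def act
    using lie_module_pullback [OF EV mod1 [unfolded sl2_module_def]]
      lie_module_pullback [OF EV mod2 [unfolded sl2_module_def]] by blast
qed

end
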